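(* Let $H$ be a finite dimensional $G$-graded $G$-module, and let $\circ$ be the multiplication on $\mathrm{Br}\llbracket H^\ast \rrbracket$ given by the composition \[ \mathrm{Br}\llbracket H^\ast \rrbracket \otimes \mathrm{Br}\llbracket H^\ast \rrbracket \hookrightarrow \mathrm{T}\llbracket H^\ast \rrbracket \otimes \mathrm{T}\llbracket H^\ast \rrbracket \xrightarrow{\mu} \mathrm{T}\llbracket H^\ast \rrbracket \xrightarrow{\mathcal{B}} \mathrm{Br}\llbracket H^\ast \rrbracket , \] where $\mu$ is juxtaposition and $\mathcal{B}=\prod_n \mathcal{B}_n$ is the total braidization. Then $(\mathrm{Br}\llbracket H^\ast \rrbracket,\circ)$ is a braided-commutative algebra with unity. Moreover, for each morphism $\phi : H \to K$ of finite dimensional $G$-graded $G$-modules, the induced linear map \[ \phi^\ast : \mathrm{Br}\llbracket K^\ast \rrbracket \to \mathrm{Br}\llbracket H^\ast \rrbracket \] is a morphism of algebras with unity.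
   Context: $G$ is a finite group and $k$ a field of characteristic zero. A $G$-graded $G$-module is a vector space $H=\bigoplus_{m\in G}H_m$ with a $G$-action satisfying $\gamma\cdot H_m = H_{\gamma m\gamma^{-1}}$; morphisms are $G$-equivariant grading-preserving linear maps. These form the braided monoidal category $D(k[G])$-$\mathbf{Mod}$ with braiding $V_g\otimes W\to W\otimes V_g$, $v\otimes w\mapsto (g\cdot w)\otimes v$ for $v\in V_g$. Hence the braid group $B_n$ acts on $V^{\otimes n}$; e.g. the generator $b_1$ sends $v_1\otimes v_2\otimes\cdots$ with $v_1\in V_{\gamma_1}$ to $(\gamma_1\cdot v_2)\otimes v_1\otimes\cdots$. For a finite dimensional object $V$, $\mathrm{T}\llbracket V\rrbracket=\prod_{n\ge0}V^{\otimes n}$, $\mathrm{Br}^nV=(V^{\otimes n})^{B_n}$ (the $B_n$-invariant tensors) and $\mathrm{Br}\llbracket V\rrbracket=\prod_{n\ge0}\mathrm{Br}^nV$. The dual $H^\ast$ is a $G$-graded $G$-module via $(\gamma\cdot x)(v)=x(\gamma^{-1}\cdot v)$ and $(H^\ast)_m=(H_{m^{-1}})^\ast$. Braidization: $B_n$ acts on $G^n$ by $b_i(\gamma_1,\dots,\gamma_n)=(\dots,\gamma_i\gamma_{i+1}\gamma_i^{-1},\gamma_i,\dots)$; a braid $b$ acting on $\boldsymbol\gamma$ determines an element $b_{\boldsymbol\gamma}\in G^n\rtimes S_n$, and the groupoid $\mathcal G^n$ has objects $G^n$ and morphisms $\boldsymbol\gamma\to\boldsymbol\gamma'$ the distinct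 such elements $b_{\boldsymbol\gamma}$ with $b\boldsymbol\gamma=\boldsymbol\gamma'$. Let $A_{\boldsymbol\gamma}$ be the set of all morphisms of $\mathcal G^n$ with source $\boldsymbol\gamma$. For $v\in V_{\boldsymbol\gamma}:=V_{\gamma_1}\otimes\cdots\otimes V_{\gamma_n}$ set $\mathcal{B}_n(v)=\frac{1}{|A_{\boldsymbol\gamma}|}\sum_{b_{\boldsymbol\gamma}\in A_{\boldsymbol\gamma}}b_{\boldsymbol\gamma}\cdot v$ (where $b_{\boldsymbol\gamma}$ acts as any braid realizing it), extended linearly; this is applied here to $V=H^\ast$. Braided-commutativity means $\circ = \circ\circ\Phi$ with $\Phi$ the braiding. *)

theory Defs
  imports Complex_Main
begin

text \<open>The finite group G is a finite type of class group_add (written additively,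
  but NOT assumed commutative: g + h is the product gh, - g the inverse, 0 the unit).
  The ground field k is a type of class field_char_0.  A G-graded G-module H is a
  k-vector space (type 'h with scalar multiplication sc), a family of subspaces Hg m
  giving a direct sum decomposition, and a linear G-action act with
  act g (Hg m) = Hg (g m g^-1).\<close>

definition ggmod ::
  "('k::field \<Rightarrow> 'h::ab_group_add \<Rightarrow> 'h) \<Rightarrow> ('g::{group_add,finite} \<Rightarrow> 'h set)
     \<Rightarrow> ('g \<Rightarrow> 'h \<Rightarrow> 'h) \<Rightarrow> bool" where
  "ggmod sc Hg act \<longleftrightarrow>
     vector_space sc \<and>
     (\<forall>m. module.subspace sc (Hg m)) \<and>
     (\<forall>v. \<exists>!c. (\<forall>m. c m \<in> Hg m) \<and> v = (\<Sum>m\<in>UNIV. c m)) \<and>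
     (\<forall>g. Vector_Spaces.linear sc sc (act g)) \<and>
     act 0 = id \<and> (\<forall>g h. act (g + h) = act g \<circ> act h) \<and>
     (\<forall>g m. act g ` Hg m = Hg (g + m - g))"

definition fdggmod ::
  "('k::field \<Rightarrow> 'h::ab_group_add \<Rightarrow> 'h) \<Rightarrow> ('g::{group_add,finite} \<Rightarrow> 'h set)
     \<Rightarrow> ('g \<Rightarrow> 'h \<Rightarrow> 'h) \<Rightarrow> bool" where
  "fdggmod sc Hg act \<longleftrightarrow> ggmod sc Hg act \<and> (\<exists>B. finite_dimensional_vector_space sc B)"

definition ggmorph ::
  "('k::field \<Rightarrow> 'h::ab_group_add \<Rightarrow> 'h) \<Rightarrow> ('g::{group_add,finite} \<Rightarrow> 'h set) \<Rightarrow> ('g \<Rightarrow> 'h \<Rightarrow> 'h)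
   \<Rightarrow> ('k \<Rightarrow> 'v::ab_group_add \<Rightarrow> 'v) \<Rightarrow> ('g \<Rightarrow> 'v set) \<Rightarrow> ('g \<Rightarrow> 'v \<Rightarrow> 'v)
   \<Rightarrow> ('h \<Rightarrow> 'v) \<Rightarrow> bool" where
  "ggmorph scH HgH actH scK HgK actK \<phi> \<longleftrightarrow>
     Vector_Spaces.linear scH scK \<phi> \<and>
     (\<forall>g v. \<phi> (actH g v) = actK g (\<phi> v)) \<and>
     (\<forall>m. \<phi> ` HgH m \<subseteq> HgK m)"

definition gproj :: "('g::{group_add,finite} \<Rightarrow> 'h::ab_group_add set) \<Rightarrow> 'g \<Rightarrow> 'h \<Rightarrow> 'h" where
  "gproj Hg m v = (THE c. (\<forall>m. c m \<in> Hg m) \<and> v = (\<Sum>m\<in>UNIV. c m)) m"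

text \<open>Model of the completed tensor algebra T[[H^*]]: since H is finite dimensional,
  (H^*)^{\<otimes>n} = (H^{\<otimes>n})^* is identified with the n-linear forms on H, and
  T[[H^*]] = prod_n (H^*)^{\<otimes>n} with functions F :: 'h list \<Rightarrow> 'k that are
  multilinear on lists of each length n (the restriction to length-n lists is the
  n-th component).  A pure tensor x1\<otimes>...\<otimes>xn corresponds to
  (v1,...,vn) \<mapsto> x1(v1)*...*xn(vn).\<close>
definition multilin :: "('k::field \<Rightarrow> 'h::ab_group_add \<Rightarrow> 'h) \<Rightarrow> ('h list \<Rightarrow> 'k) \<Rightarrow> bool" where
  "multilin sc F \<longleftrightarrow>
     (\<forall>xs ys a b v w. F (xs @ (sc a v + sc b w) # ys) = a * F (xs @ v # ys) + b * F (xs @ w # ys))"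

text \<open>Homogeneous component of F of H^*-degree gamma = (gamma_1,...,gamma_n),
  using (H^*)_c = (H_{c^-1})^*.\<close>
definition hcomp :: "('g::{group_add,finite} \<Rightarrow> 'h::ab_group_add set) \<Rightarrow> 'g list
     \<Rightarrow> ('h list \<Rightarrow> 'k::field) \<Rightarrow> 'h list \<Rightarrow> 'k" where
  "hcomp Hg \<gamma> F vs = (if length vs = length \<gamma>
       then F (map2 (\<lambda>c v. gproj Hg (- c) v) \<gamma> vs) else 0)"

text \<open>Elements of G^n \<rtimes> S_n are pairs (gs, sigma) of lists of length n; they act on
  V^{\<otimes>n} by sending v_1\<otimes>...\<otimes>v_n to the tensor whose j-th factor is
  gs_j \<cdot> v_{sigma_j}.  Transported to multilinear forms on H (V = H^*, with
  (g x)(v) = x(g^-1 v)) this is the following action.\<close>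
definition gsact :: "('g::{group_add,finite} \<Rightarrow> 'h \<Rightarrow> 'h) \<Rightarrow> 'g list \<times> nat list
     \<Rightarrow> ('h list \<Rightarrow> 'k) \<Rightarrow> 'h list \<Rightarrow> 'k" where
  "gsact act a F vs = F (map (\<lambda>i. let j = the_inv_into {..<length vs} (\<lambda>j. snd a ! j) i
                                   in act (- (fst a ! j)) (vs ! j)) [0..<length vs])"

text \<open>Composition: first a, then a'.\<close>
definition gcomp :: "'g::group_add list \<times> nat list \<Rightarrow> 'g list \<times> nat list \<Rightarrow> 'g list \<times> nat list" where
  "gcomp a' a = (map (\<lambda>j. fst a' ! j + fst a ! (snd a' ! j)) [0..<length (fst a')],
                 map (\<lambda>j. snd a ! (snd a' ! j)) [0..<length (fst a')])"

text \<open>Braid generators: (i, False) is b_{i+1} (0-based index i), (i, True) its inverse.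
  Action on degree tuples.\<close>
fun bdeg :: "nat \<times> bool \<Rightarrow> 'g::group_add list \<Rightarrow> 'g list" where
  "bdeg (i, False) \<gamma> = \<gamma>[i := \<gamma> ! i + \<gamma> ! Suc i - \<gamma> ! i, Suc i := \<gamma> ! i]"
| "bdeg (i, True) \<gamma> = \<gamma>[i := \<gamma> ! Suc i, Suc i := - (\<gamma> ! Suc i) + \<gamma> ! i + \<gamma> ! Suc i]"

fun bgen :: "nat \<times> bool \<Rightarrow> 'g::group_add list \<Rightarrow> 'g list \<times> nat list" where
  "bgen (i, False) \<gamma> = ((replicate (length \<gamma>) 0)[i := \<gamma> ! i],
                        [0..<length \<gamma>][i := Suc i, Suc i := i])"
| "bgen (i, True) \<gamma> = ((replicate (length \<gamma>) 0)[Suc i := - (\<gamma> ! Suc i)],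
                       [0..<length \<gamma>][i := Suc i, Suc i := i])"

text \<open>A braid word s_1 ... s_k (acting as s_1(s_2(...(s_k v)))) applied to gamma:
  returns the target tuple and the element b_gamma.\<close>
fun bword :: "(nat \<times> bool) list \<Rightarrow> 'g::group_add list \<Rightarrow> 'g list \<times> ('g list \<times> nat list)" where
  "bword [] \<gamma> = (\<gamma>, (replicate (length \<gamma>) 0, [0..<length \<gamma>]))"
| "bword (s # w) \<gamma> = (let (\<gamma>', a) = bword w \<gamma> in (bdeg s \<gamma>', gcomp (bgen s \<gamma>') a))"

definition valid_word :: "nat \<Rightarrow> (nat \<times> bool) list \<Rightarrow> bool" where
  "valid_word n w \<longleftrightarrow> (\<forall>s\<in>set w. Suc (fst s) < n)"

text \<open>A_gamma: all morphisms of the groupoid with source gamma.\<close>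
definition Aset :: "'g::group_add list \<Rightarrow> ('g list \<times> nat list) set" where
  "Aset \<gamma> = {snd (bword w \<gamma>) | w. valid_word (length \<gamma>) w}"

definition braid_act :: "('g::{group_add,finite} \<Rightarrow> 'h::ab_group_add set) \<Rightarrow> ('g \<Rightarrow> 'h \<Rightarrow> 'h)
     \<Rightarrow> (nat \<times> bool) list \<Rightarrow> ('h list \<Rightarrow> 'k::field) \<Rightarrow> 'h list \<Rightarrow> 'k" where
  "braid_act Hg act w F vs =
     (\<Sum>\<gamma>\<in>{\<gamma>. length \<gamma> = length vs}. gsact act (snd (bword w \<gamma>)) (hcomp Hg \<gamma> F) vs)"

definition Br :: "('k::field \<Rightarrow> 'h::ab_group_add \<Rightarrow> 'h) \<Rightarrow> ('g::{group_add,finite} \<Rightarrow> 'h set)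
     \<Rightarrow> ('g \<Rightarrow> 'h \<Rightarrow> 'h) \<Rightarrow> ('h list \<Rightarrow> 'k) set" where
  "Br sc Hg act = {F. multilin sc F \<and>
      (\<forall>w vs. valid_word (length vs) w \<longrightarrow> braid_act Hg act w F vs = F vs)}"

definition braidize :: "('g::{group_add,finite} \<Rightarrow> 'h::ab_group_add set) \<Rightarrow> ('g \<Rightarrow> 'h \<Rightarrow> 'h)
     \<Rightarrow> ('h list \<Rightarrow> 'k::field) \<Rightarrow> 'h list \<Rightarrow> 'k" where
  "braidize Hg act F vs =
     (\<Sum>\<gamma>\<in>{\<gamma>. length \<gamma> = length vs}.
        (1 / of_nat (card (Aset \<gamma>))) * (\<Sum>a\<in>Aset \<gamma>. gsact act a (hcomp Hg \<gamma> F) vs))"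

definition juxt :: "('h list \<Rightarrow> 'k::field) \<Rightarrow> ('h list \<Rightarrow> 'k) \<Rightarrow> 'h list \<Rightarrow> 'k" where
  "juxt F G vs = (\<Sum>k\<le>length vs. F (take k vs) * G (drop k vs))"

definition circ :: "('g::{group_add,finite} \<Rightarrow> 'h::ab_group_add set) \<Rightarrow> ('g \<Rightarrow> 'h \<Rightarrow> 'h)
     \<Rightarrow> ('h list \<Rightarrow> 'k::field) \<Rightarrow> ('h list \<Rightarrow> 'k) \<Rightarrow> 'h list \<Rightarrow> 'k" where
  "circ Hg act F G = braidize Hg act (juxt F G)"

definition unit1 :: "'h list \<Rightarrow> 'k::field" where
  "unit1 vs = (if vs = [] then 1 else 0)"

definition dact :: "('g::group_add \<Rightarrow> 'h \<Rightarrow> 'h) \<Rightarrow> 'g \<Rightarrow> ('h list \<Rightarrow> 'k) \<Rightarrow> 'h list \<Rightarrow> 'k" where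
  "dact act g F vs = F (map (act (- g)) vs)"

definition dcomp :: "('g::{group_add,finite} \<Rightarrow> 'h::ab_group_add set) \<Rightarrow> 'g
     \<Rightarrow> ('h list \<Rightarrow> 'k::field) \<Rightarrow> 'h list \<Rightarrow> 'k" where
  "dcomp Hg g F vs = (\<Sum>\<gamma>\<in>{\<gamma>. length \<gamma> = length vs \<and> sum_list \<gamma> = g}. hcomp Hg \<gamma> F vs)"

definition braided_comm_unital_algebra ::
  "('k::field \<Rightarrow> 'h::ab_group_add \<Rightarrow> 'h) \<Rightarrow> ('g::{group_add,finite} \<Rightarrow> 'h set)
     \<Rightarrow> ('g \<Rightarrow> 'h \<Rightarrow> 'h) \<Rightarrow> bool" where
  "braided_comm_unital_algebra sc Hg act \<longleftrightarrow>
    (let B = Br sc Hg act; m = circ Hg act in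
     \<comment> \<open>Br[[H^*]] is a G-graded G-submodule of T[[H^*]]\<close>
     (\<lambda>_. 0) \<in> B \<and>
     (\<forall>F\<in>B. \<forall>G\<in>B. (\<lambda>vs. F vs + G vs) \<in> B) \<and>
     (\<forall>a. \<forall>F\<in>B. (\<lambda>vs. a * F vs) \<in> B) \<and>
     (\<forall>g. \<forall>F\<in>B. dact act g F \<in> B) \<and>
     (\<forall>g. \<forall>F\<in>B. dcomp Hg g F \<in> B) \<and>
     \<comment> \<open>closure, bilinearity\<close>
     (\<forall>F\<in>B. \<forall>G\<in>B. m F G \<in> B) \<and>
     (\<forall>F\<in>B. \<forall>F'\<in>B. \<forall>G\<in>B. m (\<lambda>vs. F vs + F' vs) G = (\<lambda>vs. m F G vs + m F' G vs)) \<and>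
     (\<forall>F\<in>B. \<forall>G\<in>B. \<forall>G'\<in>B. m F (\<lambda>vs. G vs + G' vs) = (\<lambda>vs. m F G vs + m F G' vs)) \<and>
     (\<forall>a. \<forall>F\<in>B. \<forall>G\<in>B. m (\<lambda>vs. a * F vs) G = (\<lambda>vs. a * m F G vs)) \<and>
     (\<forall>a. \<forall>F\<in>B. \<forall>G\<in>B. m F (\<lambda>vs. a * G vs) = (\<lambda>vs. a * m F G vs)) \<and>
     \<comment> \<open>multiplication is a morphism of G-graded G-modules\<close>
     (\<forall>g. \<forall>F\<in>B. \<forall>G\<in>B. dact act g (m F G) = m (dact act g F) (dact act g G)) \<and>
     (\<forall>a b. \<forall>F\<in>B. \<forall>G\<in>B. dcomp Hg (a + b) (m (dcomp Hg a F) (dcomp Hg b G))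
                            = m (dcomp Hg a F) (dcomp Hg b G)) \<and>
     \<comment> \<open>associativity and unit\<close>
     (\<forall>F\<in>B. \<forall>G\<in>B. \<forall>E\<in>B. m (m F G) E = m F (m G E)) \<and>
     unit1 \<in> B \<and>
     (\<forall>F\<in>B. m unit1 F = F \<and> m F unit1 = F) \<and>
     \<comment> \<open>braided commutativity: m = m \<circ> Phi, Phi(x \<otimes> y) = (g y) \<otimes> x for x of degree g\<close>
     (\<forall>F\<in>B. \<forall>G\<in>B. m F G = (\<lambda>vs. \<Sum>g\<in>UNIV. m (dact act g G) (dcomp Hg g F) vs)))"

definition pullback :: "('h \<Rightarrow> 'v) \<Rightarrow> ('v list \<Rightarrow> 'k) \<Rightarrow> 'h list \<Rightarrow> 'k" where
  "pullback \<phi> F vs = F (map \<phi> vs)"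

definition unital_alg_hom ::
  "('k::field \<Rightarrow> 'h::ab_group_add \<Rightarrow> 'h) \<Rightarrow> ('g::{group_add,finite} \<Rightarrow> 'h set) \<Rightarrow> ('g \<Rightarrow> 'h \<Rightarrow> 'h)
   \<Rightarrow> ('k \<Rightarrow> 'v::ab_group_add \<Rightarrow> 'v) \<Rightarrow> ('g \<Rightarrow> 'v set) \<Rightarrow> ('g \<Rightarrow> 'v \<Rightarrow> 'v)
   \<Rightarrow> (('v list \<Rightarrow> 'k) \<Rightarrow> 'h list \<Rightarrow> 'k) \<Rightarrow> bool" where
  "unital_alg_hom scH HgH actH scK HgK actK f \<longleftrightarrow>
     (\<forall>F\<in>Br scK HgK actK. f F \<in> Br scH HgH actH) \<and>
     (\<forall>F\<in>Br scK HgK actK. \<forall>G\<in>Br scK HgK actK. f (\<lambda>vs. F vs + G vs) = (\<lambda>vs. f F vs + f G vs)) \<and>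
     (\<forall>a. \<forall>F\<in>Br scK HgK actK. f (\<lambda>vs. a * F vs) = (\<lambda>vs. a * f F vs)) \<and>
     (\<forall>F\<in>Br scK HgK actK. \<forall>G\<in>Br scK HgK actK.
        f (circ HgK actK F G) = circ HgH actH (f F) (f G)) \<and>
     f unit1 = unit1"

end

theory Submission
  imports Defs "HOL-Library.Multiset"
begin

text \<open>Braids act on lists of pairs (degree, element of a \<open>G\<close>-set) by Hurwitz moves. Evaluated on
  homogeneous vectors, braidization of a multilinear form is the average of the form over the
  Hurwitz orbit of the list of vectors, and a form is braid invariant iff it is constant on such
  orbits. The algebra laws then become statements about averages over finite orbits: averaging over
  a block of strands first changes nothing (associativity), the orbit is permuted by the braid that
  interchanges two blocks (braided commutativity), and an equivariant map between orbits has fibres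
  of equal size (\<open>G\<close>-equivariance, functoriality, and the comparison of the groupoid morphisms
  \<open>A\<^sub>\<gamma>\<close> with orbits of vectors).\<close>

section \<open>The Hurwitz action on lists of graded elements\<close>

text \<open>Vectors carry a degree label because the degree cannot be read off: the zero vector lies
  in every \<open>Hg m\<close>. Two mismatches separate the definition of braidization from an orbit
  average. First, forms pull back: evaluation at a list of degrees gamma selects the morphisms that
  END at gamma, coming from all sources delta with weight 1/|A_delta|, whereas an orbit collects the
  morphisms that START at gamma. Inverting morphisms repairs this, and the weights agree because in
  a groupoid the objects of one connected component emit equally many morphisms. Second, vectors
  have stabilisers, so distinct morphisms can have the same effect on a given list. Hence the
  morphisms are first realised as an orbit of freely permuted labels, which maps onto the orbit of
  every list of vectors with these degrees. Working with normalised averages lets the fibre sizes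
  cancel; characteristic zero makes the division by orbit sizes legitimate.\<close>

definition group_act :: "('g::group_add \<Rightarrow> 'x \<Rightarrow> 'x) \<Rightarrow> bool" where
  "group_act act \<longleftrightarrow> (\<forall>x. act 0 x = x) \<and> (\<forall>g h x. act (g + h) x = act g (act h x))"

lemma group_act_zero: "group_act act \<Longrightarrow> act 0 x = x"
  and group_act_add: "group_act act \<Longrightarrow> act (g + h) x = act g (act h x)"
  by (simp_all add: group_act_def)

lemma group_act_cancel:
  assumes "group_act act"
  shows "act g (act (- g) x) = x" "act (- g) (act g x) = x"
  using assms by (metis group_act_add group_act_zero right_minus left_minus)+

text \<open>\<open>False\<close> is the braiding of two homogeneous elements and \<open>True\<close>
  its inverse, in accordance with the flags of \<open>bdeg\<close> and \<open>bgen\<close>.\<close>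

fun hcross :: "('g::group_add \<Rightarrow> 'x \<Rightarrow> 'x) \<Rightarrow> bool \<Rightarrow> 'g \<times> 'x \<Rightarrow> 'g \<times> 'x \<Rightarrow> ('g \<times> 'x) list" where
  "hcross act False (c, x) (d, y) = [(c + d - c, act c y), (c, x)]"
| "hcross act True (c, x) (d, y) = [(d, y), (- d + c + d, act (- d) x)]"

definition hstep :: "('g::group_add \<Rightarrow> 'x \<Rightarrow> 'x) \<Rightarrow> nat \<times> bool \<Rightarrow> ('g \<times> 'x) list \<Rightarrow> ('g \<times> 'x) list" where
  "hstep act s R = take (fst s) R @ hcross act (snd s) (R ! fst s) (R ! Suc (fst s)) @ drop (fst s + 2) R"

definition hword :: "('g::group_add \<Rightarrow> 'x \<Rightarrow> 'x) \<Rightarrow> (nat \<times> bool) list \<Rightarrow> ('g \<times> 'x) list \<Rightarrow> ('g \<times> 'x) list" where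
  "hword act w R = foldr (hstep act) w R"

lemma hword_Nil [simp]: "hword act [] R = R"
  and hword_Cons [simp]: "hword act (s # w) R = hstep act s (hword act w R)"
  and hword_append: "hword act (w @ w') R = hword act w (hword act w' R)"
  by (simp_all add: hword_def)

lemma valid_word_simps [simp]:
  "valid_word n []"
  "valid_word n (s # w) \<longleftrightarrow> Suc (fst s) < n \<and> valid_word n w"
  "valid_word n (w @ w') \<longleftrightarrow> valid_word n w \<and> valid_word n w'"
  by (auto simp: valid_word_def)

lemma hstep_split: "hstep act (length P, b) (P @ p # q # Q) = P @ hcross act b p q @ Q"
  by (simp add: hstep_def nth_append)

lemma split_two:
  assumes "Suc i < length R"
  obtains P p q Q where "R = P @ p # q # Q" "length P = i"
proof
  show "R = take i R @ R ! i # R ! Suc i # drop (Suc (Suc i)) R"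
    using assms by (metis Cons_nth_drop_Suc Suc_lessD append_take_drop_id)
qed (use assms in simp)

lemma length_hcross [simp]: "length (hcross act b p q) = 2"
  by (cases b; cases p; cases q) auto

lemma length_hstep [simp]: "Suc (fst s) < length R \<Longrightarrow> length (hstep act s R) = length R"
  by (simp add: hstep_def)

lemma length_hword [simp]: "valid_word (length R) w \<Longrightarrow> length (hword act w R) = length R"
  by (induction w) auto

lemma hstep_inverse:
  assumes "group_act act" "Suc i < length R"
  shows "hstep act (i, \<not> b) (hstep act (i, b) R) = R"
proof -
  obtain P p q Q where R: "R = P @ p # q # Q" "length P = i"
    using split_two[OF assms(2)] .
  obtain c x where p: "p = (c, x)" by fastforce
  obtain d y where q: "q = (d, y)" by fastforce
  show ?thesis
    using R(2) group_act_cancel[OF assms(1)]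
    by (cases b)
      (auto simp: R(1) p q hstep_split add.assoc diff_conv_add_uminus simp del: add_uminus_conv_diff)
qed

definition winv :: "(nat \<times> bool) list \<Rightarrow> (nat \<times> bool) list" where
  "winv w = rev (map (\<lambda>(i, b). (i, \<not> b)) w)"

lemma winv_winv [simp]: "winv (winv w) = w"
  by (induction w) (auto simp: winv_def rev_map)

lemma valid_winv [simp]: "valid_word n (winv w) \<longleftrightarrow> valid_word n w"
  by (auto simp: valid_word_def winv_def)

lemma hword_winv:
  assumes "group_act act" "valid_word (length R) w"
  shows "hword act (winv w) (hword act w R) = R"
  using assms(2)
proof (induction w)
  case (Cons s w)
  obtain i b where s: "s = (i, b)" by fastforce
  have "hword act (winv (s # w)) (hword act (s # w) R)
      = hword act (winv w) (hstep act (i, \<not> b) (hstep act (i, b) (hword act w R)))"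
    by (simp add: winv_def hword_append s)
  also have "\<dots> = hword act (winv w) (hword act w R)"
    using Cons.prems by (subst hstep_inverse[OF assms(1)]) (auto simp: s)
  finally show ?case using Cons by simp
qed (simp add: winv_def)

lemma hword_winv':
  assumes "group_act act" "valid_word (length R) w"
  shows "hword act w (hword act (winv w) R) = R"
  using hword_winv[of act R "winv w"] assms by simp

text \<open>The degree labels need a map of their own: acting by a group element on vectors
  conjugates their degrees. Since \<open>k\<close> is a homomorphism, it respects the conjugations
  in \<open>hcross\<close>.\<close>

definition equivariant :: "('g::group_add \<Rightarrow> 'x \<Rightarrow> 'x) \<Rightarrow> ('g \<Rightarrow> 'y \<Rightarrow> 'y) \<Rightarrow> ('g \<Rightarrow> 'g) \<Rightarrow> ('x \<Rightarrow> 'y) \<Rightarrow> bool" where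
  "equivariant act act' k f \<longleftrightarrow> (\<forall>c d. k (c + d) = k c + k d) \<and> (\<forall>c x. f (act c x) = act' (k c) (f x))"

lemma equivariant_minus:
  assumes "equivariant act act' k f"
  shows "k (- c) = - k c" "k (c - d) = k c - k d"
proof -
  have add: "\<And>c d. k (c + d) = k c + k d" using assms by (simp add: equivariant_def)
  have "k 0 + k 0 = k 0" by (simp flip: add)
  then have 0: "k 0 = 0" by (metis add.right_neutral add_left_cancel)
  have *: "k (- c) = - k c" for c using add[of c "- c"] 0 by (simp add: eq_neg_iff_add_eq_0 minus_unique)
  show "k (- c) = - k c" "k (c - d) = k c - k d"
    using * add[of c "- d"] by simp_all
qed

lemma hword_map:
  assumes "equivariant act act' k f" "valid_word (length R) w"
  shows "hword act' w (map (map_prod k f) R) = map (map_prod k f) (hword act w R)"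
  using assms(2)
proof (induction w)
  case (Cons s w)
  obtain i b where s: "s = (i, b)" by fastforce
  have "Suc i < length (hword act w R)" using Cons.prems by (simp add: s)
  then obtain P p q Q where R: "hword act w R = P @ p # q # Q" "length P = i"
    using split_two by blast
  obtain c x where p: "p = (c, x)" by fastforce
  obtain d y where q: "q = (d, y)" by fastforce
  have IH: "hword act' w (map (map_prod k f) R) = map (map_prod k f) P @ (k c, f x) # (k d, f y) # map (map_prod k f) Q"
    using Cons R p q by simp
  have "hcross act' b (k c, f x) (k d, f y) = map (map_prod k f) (hcross act b p q)"
    using assms(1) equivariant_minus[OF assms(1)] by (cases b) (auto simp: p q equivariant_def)
  then show ?case
    using hstep_split[of act' "map (map_prod k f) P" b] hstep_split[of act P b]
    by (simp add: s IH R)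
qed simp

lemma hword_block:
  assumes "valid_word (length Q) w"
  shows "hword act (map (\<lambda>(i, b). (i + length P, b)) w) (P @ Q @ Q') = P @ hword act w Q @ Q'"
  using assms
proof (induction w)
  case (Cons s w)
  obtain i b where s: "s = (i, b)" by fastforce
  have "Suc i < length (hword act w Q)" using Cons.prems by (simp add: s)
  then obtain A p q B where R: "hword act w Q = A @ p # q # B" "length A = i"
    using split_two by blast
  show ?case
    using Cons hstep_split[of act "P @ A" b p q "B @ Q'"] hstep_split[of act A b p q B]
    by (simp add: s R add.commute)
qed simp

text \<open>Reduces a property of all braids to one crossing in an arbitrary context. It serves for
  the total degree, the finite range of entries, homogeneity, and the labels of morphisms.\<close>

lemma hword_invariant:
  assumes "valid_word (length R) w"
    and "\<And>P p q Q b. I (P @ p # q # Q) \<Longrightarrow> I (P @ hcross act b p q @ Q)"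
    and "I R"
  shows "I (hword act w R)"
  using assms(1)
proof (induction w)
  case (Cons s w)
  obtain i b where s: "s = (i, b)" by fastforce
  have "Suc i < length (hword act w R)" using Cons.prems by (simp add: s)
  then obtain A p q B where R: "hword act w R = A @ p # q # B" "length A = i"
    using split_two by blast
  show ?case
    using Cons assms(2)[of A p q B b] hstep_split[of act A b p q B]
    by (simp add: s R)
qed (use assms in simp)

text \<open>A crossing turns the product c d into (c d c^-1) c or into d (d^-1 c d), and both equal
  c d.\<close>

lemma sum_list_hword:
  assumes "valid_word (length R) w"
  shows "sum_list (map fst (hword act w R)) = sum_list (map fst R)"
proof (rule hword_invariant[where I = "\<lambda>T. sum_list (map fst T) = sum_list (map fst R)", OF assms])
  fix P Q :: "('a \<times> 'b) list" and p q b
  assume "sum_list (map fst (P @ p # q # Q)) = sum_list (map fst R)"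
  then show "sum_list (map fst (P @ hcross act b p q @ Q)) = sum_list (map fst R)"
    by (cases b; cases p; cases q) (auto simp: add.assoc[symmetric])
qed simp

text \<open>The \<open>m\<close> strands of the second block pass the \<open>l\<close> strands of
  the first one at a time; when its turn comes, strand \<open>m\<close> travels from position
  \<open>m + l\<close> down to \<open>m\<close>. The crossings are inverse because a braid acts on a
  form by moving its arguments with the inverse braid, so on forms this is the positive
  braiding.\<close>

fun swap_word :: "nat \<Rightarrow> nat \<Rightarrow> (nat \<times> bool) list" where
  "swap_word l 0 = []"
| "swap_word l (Suc m) = map (\<lambda>i. (i, True)) [m..<m + l] @ swap_word l m"

lemma valid_swap_word: "l + m \<le> n \<Longrightarrow> valid_word n (swap_word l m)"
  by (induction m) (auto simp: valid_word_def)

lemma hword_move: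
  "hword act (map (\<lambda>i. (i, True)) [length P..<length P + length A]) (P @ A @ (d, y) # Q)
    = P @ (d, y) # map (map_prod (\<lambda>c. - d + c + d) (act (- d))) A @ Q"
\<comment> \<open>The last letter of a word acts first, so the moving strand meets the last entry of
  \<open>A\<close> first.\<close>
proof (induction A arbitrary: Q rule: rev_induct)
  case (snoc p A)
  obtain c x where p: "p = (c, x)" by fastforce
  show ?case
    using snoc[of "(- d + c + d, act (- d) x) # Q"] hstep_split[of act "P @ A" True "(c, x)" "(d, y)" Q]
    by (simp add: p hword_append upt_Suc_append)
qed simp

text \<open>Each strand of \<open>B\<close> stays unchanged and acts on all of \<open>A\<close> by
  the inverse of its degree; these actions compose to the inverse of the total degree of
  \<open>B\<close>. The tail \<open>Q\<close> is general because during the induction it holds the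
  next strand of \<open>B\<close>.\<close>

lemma hword_swap_word:
  assumes "group_act act"
  shows "hword act (swap_word (length A) (length B)) (A @ B @ Q)
    = B @ map (map_prod (\<lambda>c. - sum_list (map fst B) + c + sum_list (map fst B))
                (act (- sum_list (map fst B)))) A @ Q"
proof (induction B arbitrary: Q rule: rev_induct)
  case Nil
  have "map (map_prod (\<lambda>c. c) (act 0)) A = A"
    using group_act_zero[OF assms] by (intro map_idI) auto
  then show ?case by simp
next
  case (snoc p B)
  obtain d y where p: "p = (d, y)" by fastforce
  let ?s = "sum_list (map fst B)"
  let ?A = "map (map_prod (\<lambda>c. - ?s + c + ?s) (act (- ?s))) A"
  have "act (- d) (act (- ?s) x) = act (- d - ?s) x" for x
    using group_act_add[OF assms, of "- d" "- ?s"] by simp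
  moreover have "- d + (- ?s + c + ?s) + d = - d - ?s + c + (?s + d)" for c
    by (simp add: add.assoc diff_conv_add_uminus del: add_uminus_conv_diff)
  ultimately show ?case
    using snoc[of "p # Q"] hword_move[of act B ?A d y Q]
    by (simp add: p hword_append minus_add o_def map_prod.comp prod.map_comp)
qed

section \<open>Orbits and averages\<close>

definition horb :: "('g::group_add \<Rightarrow> 'x \<Rightarrow> 'x) \<Rightarrow> ('g \<times> 'x) list \<Rightarrow> ('g \<times> 'x) list set" where
  "horb act R = {hword act w R | w. valid_word (length R) w}"

lemma horb_self [simp]: "R \<in> horb act R"
  unfolding horb_def by (metis (mono_tags, lifting) hword_Nil mem_Collect_eq valid_word_simps(1))

lemma horb_nonempty [simp]: "horb act R \<noteq> {}"
  using horb_self by blast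

lemma horb_length: "T \<in> horb act R \<Longrightarrow> length T = length R"
  by (auto simp: horb_def)

lemma horb_hword: "valid_word (length R) w \<Longrightarrow> T \<in> horb act R \<Longrightarrow> hword act w T \<in> horb act R"
  unfolding horb_def by (force simp flip: hword_append)

lemma horb_sym:
  assumes "group_act act" "T \<in> horb act R"
  shows "R \<in> horb act T"
proof -
  obtain w where w: "T = hword act w R" "valid_word (length R) w"
    using assms(2) by (auto simp: horb_def)
  then have "R = hword act (winv w) T" "valid_word (length T) (winv w)"
    using hword_winv[OF assms(1)] by auto
  then show ?thesis by (auto simp: horb_def)
qed

lemma horb_trans: "T \<in> horb act R \<Longrightarrow> S \<in> horb act T \<Longrightarrow> S \<in> horb act R"
  using horb_hword[where R = R and T = T] horb_length[of T act R] by (force simp: horb_def[of act T])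

lemma horb_eq:
  assumes "group_act act" "T \<in> horb act R"
  shows "horb act T = horb act R"
  using assms horb_sym horb_trans by blast

lemma horb_map:
  assumes "equivariant act act' k f"
  shows "horb act' (map (map_prod k f) R) = map (map_prod k f) ` horb act R"
  by (auto simp: horb_def hword_map[OF assms] image_iff) (metis hword_map[OF assms])+

lemma bij_hword_horb:
  assumes "group_act act" "valid_word (length R) w"
  shows "bij_betw (hword act w) (horb act R) (horb act R)"
proof (rule bij_betw_byWitness[where f' = "hword act (winv w)"])
  show "\<forall>T\<in>horb act R. hword act (winv w) (hword act w T) = T"
    "\<forall>T\<in>horb act R. hword act w (hword act (winv w) T) = T"
    using assms hword_winv hword_winv' horb_length by metis+
qed (use assms horb_hword in \<open>auto simp: horb_hword\<close>)

text \<open>The vector space may be infinite, but a crossing only moves entries and acts on them, so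
  they remain in the finite union of the \<open>G\<close>-orbits of the entries of
  \<open>R\<close>.\<close>

lemma finite_horb:
  fixes act :: "'g::{group_add,finite} \<Rightarrow> 'x \<Rightarrow> 'x"
  assumes "group_act act"
  shows "finite (horb act R)"
proof -
  define X where "X = (\<Union>g. act g ` snd ` set R)"
  have X: "act g x \<in> X" if x: "x \<in> X" for g x
  proof -
    obtain h y where "x = act h y" "y \<in> snd ` set R" using x unfolding X_def by blast
    then have "act (g + h) y \<in> X" unfolding X_def by blast
    then show ?thesis by (simp add: \<open>x = act h y\<close> group_act_add[OF assms])
  qed
  have "horb act R \<subseteq> {T. set T \<subseteq> UNIV \<times> X \<and> length T = length R}"
  proof
    fix T assume T: "T \<in> horb act R"
    then obtain w where w: "T = hword act w R" "valid_word (length R) w" by (auto simp: horb_def)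
    have "snd ` set (hword act w R) \<subseteq> X"
    proof (rule hword_invariant[where I = "\<lambda>T. snd ` set T \<subseteq> X", OF w(2)])
      fix P Q :: "('g \<times> 'x) list" and p q b
      assume "snd ` set (P @ p # q # Q) \<subseteq> X"
      then show "snd ` set (P @ hcross act b p q @ Q) \<subseteq> X"
        using X by (cases b; cases p; cases q) auto
    next
      show "snd ` set R \<subseteq> X"
      proof
        fix x assume "x \<in> snd ` set R"
        then have "act 0 x \<in> X" unfolding X_def by blast
        then show "x \<in> X" by (simp add: group_act_zero[OF assms])
      qed
    qed
    then show "T \<in> {T. set T \<subseteq> UNIV \<times> X \<and> length T = length R}"
      using w horb_length[OF T] by auto
  qed
  moreover have "finite {T. set T \<subseteq> (UNIV :: 'g set) \<times> X \<and> length T = length R}"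
    by (intro finite_lists_length_eq finite_cartesian_product) (auto simp: X_def)
  ultimately show ?thesis by (rule finite_subset)
qed

section \<open>Averages over Hurwitz orbits\<close>

definition hav :: "('g::group_add \<Rightarrow> 'x \<Rightarrow> 'x) \<Rightarrow> (('g \<times> 'x) list \<Rightarrow> 'k::field) \<Rightarrow> ('g \<times> 'x) list \<Rightarrow> 'k" where
  "hav act f R = (\<Sum>T\<in>horb act R. f T) / of_nat (card (horb act R))"

lemma hav_cong: "(\<And>T. T \<in> horb act R \<Longrightarrow> f T = f' T) \<Longrightarrow> hav act f R = hav act f' R"
  by (simp add: hav_def)

lemma hav_sum: "hav act (\<lambda>T. \<Sum>i\<in>I. f i T) R = (\<Sum>i\<in>I. hav act (f i) R)"
  unfolding hav_def by (subst sum.swap) (simp add: sum_divide_distrib)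

lemma hav_mult_right: "hav act (\<lambda>T. f T * a) R = hav act f R * a"
  and hav_mult_left: "hav act (\<lambda>T. a * f T) R = a * hav act f R"
  by (simp_all add: hav_def sum_distrib_right sum_distrib_left)

lemma hav_const:
  fixes act :: "'g::{group_add,finite} \<Rightarrow> 'x \<Rightarrow> 'x" and f :: "_ \<Rightarrow> 'k::field_char_0"
  assumes "group_act act" "\<And>T. T \<in> horb act R \<Longrightarrow> f T = a"
  shows "hav act f R = a"
  using finite_horb[OF assms(1), of R] assms(2) by (simp add: hav_def card_eq_0_iff)

lemma hav_orbit:
  assumes "group_act act" "T \<in> horb act R"
  shows "hav act f T = hav act f R"
  using horb_eq[OF assms] by (simp add: hav_def)

lemma hav_hword:
  assumes "group_act act" "valid_word (length R) w"
  shows "hav act (\<lambda>T. f (hword act w T)) R = hav act f R"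
  unfolding hav_def using sum.reindex_bij_betw[OF bij_hword_horb[OF assms], of f] by simp

lemma average_uniform_fibres:
  fixes f :: "'b \<Rightarrow> 'k::field_char_0"
  assumes "finite A" "A \<noteq> {}" "\<And>y. y \<in> h ` A \<Longrightarrow> card {x \<in> A. h x = y} = c"
  shows "(\<Sum>y\<in>h ` A. f y) / of_nat (card (h ` A)) = (\<Sum>x\<in>A. f (h x)) / of_nat (card A)"
proof -
  have "(\<Sum>x\<in>A. f (h x)) = (\<Sum>y\<in>h ` A. \<Sum>x\<in>{x \<in> A. h x = y}. f (h x))"
    using assms(1) by (rule sum.image_gen)
  also have "\<dots> = of_nat c * (\<Sum>y\<in>h ` A. f y)"
    unfolding sum_distrib_left
  proof (intro sum.cong refl)
    fix y assume y: "y \<in> h ` A"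
    have "(\<Sum>x\<in>{x \<in> A. h x = y}. f (h x)) = (\<Sum>x\<in>{x \<in> A. h x = y}. f y)"
      by (intro sum.cong) auto
    then show "(\<Sum>x\<in>{x \<in> A. h x = y}. f (h x)) = of_nat c * f y"
      using assms(3)[OF y] by simp
  qed
  finally have s: "(\<Sum>x\<in>A. f (h x)) = of_nat c * (\<Sum>y\<in>h ` A. f y)" .
  have "card A = (\<Sum>y\<in>h ` A. card {x \<in> A. h x = y})"
    using sum.image_gen[OF assms(1), of "\<lambda>_. 1::nat" h] by simp
  then have "card A = c * card (h ` A)" using assms(3) by simp
  \<comment> \<open>A nonempty \<open>A\<close> excludes \<open>c = 0\<close>, so
    \<open>of_nat c\<close> can be cancelled in characteristic zero.\<close>
  moreover from this have "c \<noteq> 0" using assms(1,2) by auto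
  ultimately show ?thesis by (simp add: s)
qed

text \<open>A braid that carries the image of \<open>R\<close> to another point \<open>S\<close> of
  the image orbit permutes the source orbit and takes the fibre over the image of \<open>R\<close>
  bijectively to the fibre over \<open>S\<close>.\<close>

lemma hav_map:
  fixes act :: "'g::{group_add,finite} \<Rightarrow> 'x \<Rightarrow> 'x" and f :: "_ \<Rightarrow> 'k::field_char_0"
  assumes "equivariant act act' k h" "group_act act" "group_act act'"
  shows "hav act' f (map (map_prod k h) R) = hav act (\<lambda>T. f (map (map_prod k h) T)) R"
proof -
  let ?h = "map (map_prod k h)"
  have "card {T \<in> horb act R. ?h T = S} = card {T \<in> horb act R. ?h T = ?h R}"
    if S: "S \<in> ?h ` horb act R" for S
  proof -
    obtain w where w: "S = ?h (hword act w R)" "valid_word (length R) w"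
      using S unfolding horb_def by blast
    have S: "S = hword act' w (?h R)" using hword_map[OF assms(1) w(2)] w(1) by simp
    have "?h (hword act w T) = S \<longleftrightarrow> ?h T = ?h R" if "T \<in> horb act R" for T
    proof -
      have l: "length T = length R" using that by (rule horb_length)
      have "?h (hword act w T) = hword act' w (?h T)" using hword_map[OF assms(1)] w(2) l by simp
      then show ?thesis using S hword_winv[OF assms(3)] w(2) l by (metis length_map)
    qed
    then have "{T \<in> hword act w ` horb act R. ?h T = S} = hword act w ` {T \<in> horb act R. ?h T = ?h R}"
      by blast
    then have "{T \<in> horb act R. ?h T = S} = hword act w ` {T \<in> horb act R. ?h T = ?h R}"
      using bij_hword_horb[OF assms(2) w(2)] by (simp add: bij_betw_def)
    moreover have "inj_on (hword act w) {T \<in> horb act R. ?h T = ?h R}"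
      using bij_hword_horb[OF assms(2) w(2)] by (auto simp: bij_betw_def inj_on_def)
    ultimately show ?thesis by (simp add: card_image)
  qed
  then show ?thesis
    unfolding hav_def horb_map[OF assms(1)]
    by (rule average_uniform_fibres[OF finite_horb[OF assms(2)] horb_nonempty])
qed

text \<open>The sets \<open>C x\<close> partition \<open>A\<close>. After exchanging the sums, the
  value at \<open>y\<close> is counted once for each member of its class, each time divided by the
  size of that class.\<close>

lemma sum_average_classes:
  fixes f :: "'a \<Rightarrow> 'k::field_char_0"
  assumes "finite A" "\<And>x. x \<in> A \<Longrightarrow> C x \<subseteq> A" "\<And>x. x \<in> A \<Longrightarrow> x \<in> C x"
    and "\<And>x y. x \<in> A \<Longrightarrow> y \<in> C x \<Longrightarrow> C y = C x"
  shows "(\<Sum>x\<in>A. (\<Sum>y\<in>C x. f y) / of_nat (card (C x))) = (\<Sum>x\<in>A. f x)"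
proof -
  have C: "C x = {y \<in> A. y \<in> C x}" "{y \<in> A. x \<in> C y} = C x" if "x \<in> A" for x
    using assms(2-4) that by blast+
  have "(\<Sum>x\<in>A. (\<Sum>y\<in>C x. f y) / of_nat (card (C x)))
      = (\<Sum>x\<in>A. \<Sum>y\<in>{y \<in> A. y \<in> C x}. f y / of_nat (card (C y)))"
  proof (intro sum.cong refl)
    fix x assume x: "x \<in> A"
    have "(\<Sum>y\<in>C x. f y) / of_nat (card (C x)) = (\<Sum>y\<in>C x. f y / of_nat (card (C y)))"
      unfolding sum_divide_distrib using assms(4)[OF x] by (intro sum.cong) simp_all
    also have "\<dots> = (\<Sum>y\<in>{y \<in> A. y \<in> C x}. f y / of_nat (card (C y)))"
      by (rule sum.cong[OF C(1)[OF x] refl])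
    finally show "(\<Sum>y\<in>C x. f y) / of_nat (card (C x))
        = (\<Sum>y\<in>{y \<in> A. y \<in> C x}. f y / of_nat (card (C y)))" .
  qed
  also have "\<dots> = (\<Sum>y\<in>A. \<Sum>x\<in>{x \<in> A. y \<in> C x}. f y / of_nat (card (C y)))"
    using assms(1) by (intro sum.swap_restrict)
  also have "\<dots> = (\<Sum>y\<in>A. f y)"
  proof (intro sum.cong refl)
    fix y assume "y \<in> A"
    then have "card (C y) \<noteq> 0"
      using assms(1-3) by (metis card_eq_0_iff empty_iff finite_subset)
    then show "(\<Sum>x\<in>{x \<in> A. y \<in> C x}. f y / of_nat (card (C y))) = f y"
      using C(2) \<open>y \<in> A\<close> by simp
  qed
  finally show ?thesis .
qed

text \<open>The words supported on a block of strands cut the full orbit into classes, each a copy of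
  the orbit of the block, so averaging over the block first changes nothing.\<close>

lemma hav_block:
  fixes act :: "'g::{group_add,finite} \<Rightarrow> 'x \<Rightarrow> 'x" and f :: "_ \<Rightarrow> 'k::field_char_0"
  assumes "group_act act" "k + m \<le> length R"
  shows "hav act (\<lambda>T. hav act (\<lambda>S. f (take k T @ S @ drop (k + m) T)) (take m (drop k T))) R
    = hav act f R"
proof -
  define C where "C T = (\<lambda>S. take k T @ S @ drop (k + m) T) ` horb act (take m (drop k T))" for T
  have len: "length (take m (drop k T)) = m" "length (take k T) = k"
    and split: "T = take k T @ take m (drop k T) @ drop (k + m) T"
    if "T \<in> horb act R" for T
    using horb_length[OF that] assms(2)
     by (simp_all add: add.commute) (metis append_take_drop_id drop_drop add.commute)
  \<comment> \<open>Gluing the block back is injective, so the class \<open>C T\<close> has the size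
    of the orbit of the block and the inner average is the average over \<open>C T\<close>.\<close>
  have inj: "inj_on (\<lambda>S. take k T @ S @ drop (k + m) T) X" for T X
    by (auto simp: inj_on_def)
  have 1: "C T \<subseteq> horb act R" if T: "T \<in> horb act R" for T
  proof
    fix T' assume "T' \<in> C T"
    then obtain w where w: "valid_word m w"
        "T' = take k T @ hword act w (take m (drop k T)) @ drop (k + m) T"
      using len[OF T] by (auto simp: C_def horb_def)
    then have "T' = hword act (map (\<lambda>(i, b). (i + k, b)) w) T"
      using hword_block[of "take m (drop k T)" w act "take k T" "drop (k + m) T"] len[OF T] split[OF T]
      by simp
    moreover have "valid_word (length R) (map (\<lambda>(i, b). (i + k, b)) w)"
      using w(1) assms(2) by (fastforce simp: valid_word_def)
    ultimately show "T' \<in> horb act R" using T horb_hword by blast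
  qed
  have 2: "T \<in> C T" if "T \<in> horb act R" for T
    unfolding C_def using split[OF that] horb_self by blast
  have 3: "C T' = C T" if T: "T \<in> horb act R" and T': "T' \<in> C T" for T T'
  proof -
    obtain S where S: "S \<in> horb act (take m (drop k T))" "T' = take k T @ S @ drop (k + m) T"
      using T' by (auto simp: C_def)
    have "length S = m" using horb_length[OF S(1)] len[OF T] by simp
    then have "take k T' = take k T" "take m (drop k T') = S" "drop (k + m) T' = drop (k + m) T"
      using len(2)[OF T] by (simp_all add: S(2))
    then show ?thesis using horb_eq[OF assms(1) S(1)] by (simp add: C_def)
  qed
  have "hav act (\<lambda>T. hav act (\<lambda>S. f (take k T @ S @ drop (k + m) T)) (take m (drop k T))) R
    = hav act (\<lambda>T. (\<Sum>S\<in>C T. f S) / of_nat (card (C T))) R"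
    unfolding C_def by (simp add: hav_def sum.reindex[OF inj] card_image[OF inj])
  also have "\<dots> = hav act f R"
    using sum_average_classes[OF finite_horb[OF assms(1)] 1 2 3, where f = f] by (simp add: hav_def)
  finally show ?thesis .
qed

section \<open>Morphisms of the braid groupoid as states\<close>

text \<open>Acting on the regular \<open>G\<close>-set in each position records the element of
  \<open>G\<^sup>n \<rtimes> S\<^sub>n\<close> realised by a braid, so the Hurwitz orbit of \<open>ustate \<gamma>\<close> is a copy of \<open>A\<^sub>\<gamma>\<close>.\<close>

definition ushift :: "'g::group_add \<Rightarrow> 'g \<times> nat \<Rightarrow> 'g \<times> nat" where
  "ushift g x = (g + fst x, snd x)"

definition ustate :: "'g::group_add list \<Rightarrow> ('g \<times> 'g \<times> nat) list" where
  "ustate \<gamma> = map (\<lambda>i. (\<gamma> ! i, 0, i)) [0..<length \<gamma>]"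

definition mor_of :: "('g \<times> 'g \<times> nat) list \<Rightarrow> 'g list \<times> nat list" where
  "mor_of P = (map (fst \<circ> snd) P, map (snd \<circ> snd) P)"

abbreviation uorb :: "'g::group_add list \<Rightarrow> ('g \<times> 'g \<times> nat) list set" where
  "uorb \<gamma> \<equiv> horb ushift (ustate \<gamma>)"

lemma group_act_ushift: "group_act ushift"
  by (simp add: group_act_def ushift_def add.assoc)

lemma length_ustate [simp]: "length (ustate \<gamma>) = length \<gamma>"
  by (simp add: ustate_def)

lemma fst_ustate [simp]: "map fst (ustate \<gamma>) = \<gamma>"
  by (simp add: ustate_def o_def map_nth)

lemma bdeg_hstep:
  assumes "Suc (fst s) < length P"
  shows "bdeg s (map fst P) = map fst (hstep act s P)"
proof -
  obtain i b where s: "s = (i, b)" by fastforce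
  obtain A p q B where P: "P = A @ p # q # B" "length A = i"
    using split_two[OF assms] by (metis s fst_conv)
  show ?thesis
    using hstep_split[of act A b p q B] P(2)
    by (cases b; cases p; cases q) (auto simp: s P(1) list_update_append nth_append)
qed

text \<open>A crossing multiplies the recorded group element on the left and exchanges two recorded
  positions, which is composition with a generator in the wreath product. Only the entries
  \<open>i\<close> and \<open>Suc i\<close> need inspection.\<close>

lemma gcomp_hstep:
  fixes P :: "('g::group_add \<times> 'g \<times> nat) list"
  assumes "Suc (fst s) < length P"
  shows "gcomp (bgen s (map fst P)) (mor_of P) = mor_of (hstep ushift s P)"
proof -
  obtain i b where s: "s = (i, b)" by fastforce
  have i: "Suc i < length P" using assms by (simp add: s)
  then obtain A p q B where P: "P = A @ p # q # B" "length A = i"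
    using split_two by blast
  let ?\<sigma> = "[0..<length P][i := Suc i, Suc i := i]"
  let ?H = "hstep ushift s P"
  obtain c g x where p: "p = (c, g, x)" using prod_cases3 by blast
  obtain d h y where q: "q = (d, h, y)" using prod_cases3 by blast
  have nth: "P ! i = p" "P ! Suc i = q" using P by (auto simp: nth_append)
  have lb: "length (fst (bgen s (map fst P))) = length P" by (cases b) (simp_all add: s)
  have H: "?H = A @ hcross ushift b p q @ B"
    using hstep_split[of ushift A b p q B] P by (simp add: s)
  have Hn: "?H ! j = P ! j" if "j \<noteq> i" "j \<noteq> Suc i" "j < length P" for j
  proof (cases "j < i")
    case False
    then have "Suc (Suc i) \<le> j" using that by linarith
    then obtain m where "j = Suc (Suc i) + m" using le_Suc_ex by blast
    then show ?thesis unfolding H using P by (cases b) (auto simp: p q nth_append)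
  qed (unfold H, use P in \<open>auto simp: nth_append\<close>)
  have Hi: "?H ! i = (if b then q else (c + d - c, c + h, y))"
    "?H ! Suc i = (if b then (- d + c + d, - d + g, x) else p)"
    unfolding H using P by (auto simp: p q nth_append ushift_def)
  have "length ?H = length P" using i by (simp add: s)
  moreover have "fst (bgen s (map fst P)) ! j + map (fst \<circ> snd) P ! (snd (bgen s (map fst P)) ! j)
        = fst (snd (?H ! j))"
      "map (snd \<circ> snd) P ! (snd (bgen s (map fst P)) ! j) = snd (snd (?H ! j))"
    if "j < length P" for j
    using that i Hn[of j] Hi nth p q
    by (cases b; cases "j = i"; cases "j = Suc i"; simp add: s nth_list_update)+
  ultimately show ?thesis
    unfolding gcomp_def mor_of_def fst_conv snd_conv lb by (auto intro!: nth_equalityI)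
qed

lemma bword_ustate:
  assumes "valid_word (length \<gamma>) w"
  shows "bword w \<gamma> = (map fst (hword ushift w (ustate \<gamma>)), mor_of (hword ushift w (ustate \<gamma>)))"
  using assms
proof (induction w)
  case Nil
  then show ?case
    by (simp add: mor_of_def ustate_def o_def map_replicate_const map_nth)
next
  case (Cons s w)
  then show ?case
    by (simp add: bdeg_hstep[where act = ushift] gcomp_hstep)
qed

lemma Aset_uorb: "Aset \<gamma> = mor_of ` uorb \<gamma>"
  unfolding Aset_def horb_def using bword_ustate[of \<gamma>] by force

text \<open>The label \<open>(g, i)\<close> says that this entry is the original strand
  \<open>i\<close> moved by \<open>g\<close>, and moving by \<open>g\<close> conjugates its
  degree.\<close>

lemma uorb_degree:
  assumes "P \<in> uorb \<gamma>" "(c, g, i) \<in> set P"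
  shows "c = g + \<gamma> ! i - g"
proof -
  obtain w where w: "P = hword ushift w (ustate \<gamma>)" "valid_word (length (ustate \<gamma>)) w"
    using assms(1) by (auto simp: horb_def)
  have "\<forall>(c, g, i)\<in>set P. c = g + \<gamma> ! i - g"
    unfolding w(1)
  proof (rule hword_invariant[OF w(2)])
    fix P Q :: "('a \<times> 'a \<times> nat) list" and p q b
    assume "\<forall>(c, g, i)\<in>set (P @ p # q # Q). c = g + \<gamma> ! i - g"
    then show "\<forall>(c, g, i)\<in>set (P @ hcross ushift b p q @ Q). c = g + \<gamma> ! i - g"
      by (cases b; cases p; cases q)
        (auto simp: ushift_def add.assoc diff_conv_add_uminus minus_add simp del: add_uminus_conv_diff)
  qed (auto simp: ustate_def)
  then show ?thesis using assms(2) by auto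
qed

lemma uorb_perm:
  assumes "P \<in> uorb \<gamma>"
  shows "mset (map (snd \<circ> snd) P) = mset [0..<length \<gamma>]"
proof -
  obtain w where w: "P = hword ushift w (ustate \<gamma>)" "valid_word (length (ustate \<gamma>)) w"
    using assms(1) by (auto simp: horb_def)
  show ?thesis
    unfolding w(1)
  proof (rule hword_invariant[OF w(2)])
    fix P Q :: "('a \<times> 'a \<times> nat) list" and p q b
    assume "mset (map (snd \<circ> snd) (P @ p # q # Q)) = mset [0..<length \<gamma>]"
    then show "mset (map (snd \<circ> snd) (P @ hcross ushift b p q @ Q)) = mset [0..<length \<gamma>]"
      by (cases b; cases p; cases q) (simp_all add: ushift_def add_mset_commute)
  qed (simp add: ustate_def o_def)
qed

lemma uorb_bij:
  assumes "P \<in> uorb \<gamma>"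
  shows "bij_betw (\<lambda>j. map (snd \<circ> snd) P ! j) {..<length \<gamma>} {..<length \<gamma>}"
proof -
  have l: "length (map (snd \<circ> snd) P) = length \<gamma>" using horb_length[OF assms] by simp
  have "set (map (snd \<circ> snd) P) = {..<length \<gamma>}"
    using uorb_perm[OF assms] by (metis atLeast_upt mset_eq_setD)
  moreover have "distinct (map (snd \<circ> snd) P)"
    using uorb_perm[OF assms] by (metis distinct_upt mset_eq_imp_distinct_iff)
  ultimately show ?thesis
    using bij_betw_nth[of "map (snd \<circ> snd) P" "{..<length \<gamma>}"] l by metis
qed

text \<open>\<open>mor_of\<close> forgets the degrees, but \<open>uorb_degree\<close> recovers them
  from the labels and the source. So sums and cardinalities over \<open>Aset\<close> transfer to the
  orbit.\<close>

lemma inj_on_mor_of: "inj_on mor_of (uorb \<gamma>)"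
proof (rule inj_onI)
  fix P Q assume P: "P \<in> uorb \<gamma>" and Q: "Q \<in> uorb \<gamma>" and eq: "mor_of P = mor_of Q"
  show "P = Q"
  proof (rule nth_equalityI)
    show "length P = length Q" using P Q by (simp add: horb_length)
    fix j assume "j < length P"
    with P Q have j: "j < length P" "j < length Q" by (simp_all add: horb_length)
    obtain c g i where p: "P ! j = (c, g, i)" using prod_cases3 by blast
    obtain d h k where q: "Q ! j = (d, h, k)" using prod_cases3 by blast
    have "map (fst \<circ> snd) P ! j = map (fst \<circ> snd) Q ! j" "map (snd \<circ> snd) P ! j = map (snd \<circ> snd) Q ! j"
      using eq by (simp_all add: mor_of_def)
    then have "g = h" "i = k" using j p q by simp_all
    then show "P ! j = Q ! j"
      using uorb_degree[OF P, of c g i] uorb_degree[OF Q, of d h k] j p q by (metis nth_mem)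
  qed
qed

section \<open>Evaluation and inversion of groupoid morphisms\<close>

definition uev :: "('g \<Rightarrow> 'x \<Rightarrow> 'x) \<Rightarrow> ('g \<times> 'x) list \<Rightarrow> 'g \<times> nat \<Rightarrow> 'x" where
  "uev act R x = act (fst x) (snd (R ! snd x))"

lemma equivariant_uev: "group_act act \<Longrightarrow> equivariant ushift act (\<lambda>c. c) (uev act R)"
  by (simp add: equivariant_def uev_def ushift_def group_act_add)

lemma map_uev_ustate:
  assumes "group_act act"
  shows "map (map_prod (\<lambda>c. c) (uev act R)) (ustate (map fst R)) = R"
  by (rule nth_equalityI) (simp_all add: ustate_def uev_def group_act_zero[OF assms])

text \<open>The labels form a free \<open>G\<close>-set, so \<open>ustate\<close> maps equivariantly
  to any list with the same degrees. The effect of a braid on \<open>R\<close> is therefore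
  determined by the morphism that the braid realises.\<close>

lemma hword_uev:
  assumes "group_act act" "valid_word (length R) w"
  shows "hword act w R = map (map_prod (\<lambda>c. c) (uev act R)) (hword ushift w (ustate (map fst R)))"
  using hword_map[OF equivariant_uev[OF assms(1), of R], of "ustate (map fst R)" w] assms
  by (simp add: map_uev_ustate)

lemma fst_hword:
  assumes "group_act act" "valid_word (length R) w"
  shows "map fst (hword act w R) = map fst (hword ushift w (ustate (map fst R)))"
  by (simp add: hword_uev[OF assms] o_def fst_map_prod)

text \<open>This is what \<open>gsact\<close> does to the arguments of a form, with degree labels
  attached. It makes sense for every \<open>R\<close>, as needed for the multilinearity of
  \<open>gsact\<close>; it is an inverse braid when the degrees of \<open>R\<close> are those at the
  target of \<open>P\<close>.\<close>

definition hinv :: "('g::group_add \<Rightarrow> 'x \<Rightarrow> 'x) \<Rightarrow> ('g \<times> 'g \<times> nat) list \<Rightarrow> ('g \<times> 'x) list \<Rightarrow> ('g \<times> 'x) list" where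
  "hinv act P R = map (\<lambda>i. let j = the_inv_into {..<length R} (\<lambda>j. map (snd \<circ> snd) P ! j) i; g = fst (snd (P ! j))
      in (- g + fst (R ! j) + g, act (- g) (snd (R ! j)))) [0..<length R]"

lemma length_hinv [simp]: "length (hinv act P R) = length R"
  by (simp add: hinv_def)

lemma hinv_nth:
  assumes "P \<in> uorb \<gamma>" "length R = length \<gamma>" "j < length \<gamma>" "P ! j = (c, g, i)"
  shows "i < length \<gamma>" "hinv act P R ! i = (- g + fst (R ! j) + g, act (- g) (snd (R ! j)))"
proof -
  note bij = uorb_bij[OF assms(1)]
  have i: "map (snd \<circ> snd) P ! j = i" using assms(3,4) horb_length[OF assms(1)] by simp
  then show "i < length \<gamma>" using bij assms(3) by (auto simp: bij_betw_def)
  have "the_inv_into {..<length \<gamma>} (\<lambda>j. map (snd \<circ> snd) P ! j) i = j"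
    using bij assms(3) i the_inv_into_f_f[of "\<lambda>j. map (snd \<circ> snd) P ! j" "{..<length \<gamma>}" j]
    by (auto simp: bij_betw_def)
  then show "hinv act P R ! i = (- g + fst (R ! j) + g, act (- g) (snd (R ! j)))"
    using \<open>i < length \<gamma>\<close> assms by (simp add: hinv_def Let_def)
qed

lemma hinv_nth_ex:
  assumes "P \<in> uorb \<gamma>" "i < length \<gamma>"
  obtains j c g where "j < length \<gamma>" "P ! j = (c, g, i)"
proof -
  have "i \<in> (\<lambda>j. map (snd \<circ> snd) P ! j) ` {..<length \<gamma>}"
    unfolding bij_betw_imp_surj_on[OF uorb_bij[OF assms(1)]] using assms(2) by simp
  then obtain j where j: "j < length \<gamma>" "map (snd \<circ> snd) P ! j = i" by blast
  obtain c g i' where "P ! j = (c, g, i')" using prod_cases3 by blast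
  then show ?thesis using that j horb_length[OF assms(1)] by simp
qed

text \<open>Both sides express that the degrees of \<open>R\<close> arise from \<gamma> by the
  conjugations recorded in \<open>P\<close>. This decides which morphisms survive the projection in
  \<open>hcomp\<close>.\<close>

lemma fst_hinv_iff:
  assumes P: "P \<in> uorb \<gamma>" and R: "length R = length \<gamma>"
  shows "map fst (hinv act P R) = \<gamma> \<longleftrightarrow> map fst P = map fst R"
proof
  have lP: "length P = length \<gamma>" using horb_length[OF P] by simp
  have conj: "c = g + d - g \<longleftrightarrow> d = - g + c + g" for c d g :: 'a
    by (auto simp: add.assoc diff_conv_add_uminus simp del: add_uminus_conv_diff)
  {
    assume eq: "map fst (hinv act P R) = \<gamma>"
    show "map fst P = map fst R"
    proof (rule nth_equalityI)
      fix j assume "j < length (map fst P)"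
      then have j: "j < length \<gamma>" using lP by simp
      obtain c g i where p: "P ! j = (c, g, i)" using prod_cases3 by blast
      have "\<gamma> ! i = - g + fst (R ! j) + g"
        using hinv_nth(1)[OF P R j p] hinv_nth(2)[OF P R j p, of act] R by (subst eq[symmetric]) simp
      moreover have "c = g + \<gamma> ! i - g"
        using uorb_degree[OF P] p j lP by (metis nth_mem)
      ultimately show "map fst P ! j = map fst R ! j"
        using j lP R p conj by simp
    qed (use lP R in simp)
  }
  assume eq: "map fst P = map fst R"
  show "map fst (hinv act P R) = \<gamma>"
  proof (rule nth_equalityI)
    fix i assume "i < length (map fst (hinv act P R))"
    then have i: "i < length \<gamma>" using R by simp
    then obtain j c g where j: "j < length \<gamma>" "P ! j = (c, g, i)"
      using hinv_nth_ex[OF P] by blast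
    have "c = g + \<gamma> ! i - g"
      using uorb_degree[OF P] j lP by (metis nth_mem)
    moreover have "fst (R ! j) = c"
      using arg_cong[OF eq, of "\<lambda>l. l ! j"] j lP R by simp
    ultimately show "map fst (hinv act P R) ! i = \<gamma> ! i"
      using hinv_nth(2)[OF P R j, of act] conj i R by simp
  qed (use R in simp)
qed

lemma hinv_hword:
  assumes "group_act act" "valid_word (length \<gamma>) w" "P = hword ushift w (ustate \<gamma>)" "map fst P = map fst R"
  shows "hinv act P R = hword act (winv w) R"
proof -
  have P: "P \<in> uorb \<gamma>" using assms(2,3) by (auto simp: horb_def)
  have R: "length R = length \<gamma>" using assms(4) horb_length[OF P] by (metis length_map length_ustate)
  have \<gamma>: "map fst (hinv act P R) = \<gamma>" using fst_hinv_iff[OF P R] assms(4) by blast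
  \<comment> \<open>Applying \<open>w\<close> forwards evaluates the labels of \<open>P\<close> at
    \<open>hinv act P R\<close>, where each group element meets its own inverse; the claim follows
    by cancelling \<open>w\<close>.\<close>
  have "hword act w (hinv act P R) = map (map_prod (\<lambda>c. c) (uev act (hinv act P R))) P"
    using hword_uev[OF assms(1), of "hinv act P R" w] \<gamma> R assms(2,3) by simp
  also have "\<dots> = R"
  proof (rule nth_equalityI)
    fix j assume "j < length (map (map_prod (\<lambda>c. c) (uev act (hinv act P R))) P)"
    then have j: "j < length \<gamma>" using horb_length[OF P] by simp
    obtain c g i where p: "P ! j = (c, g, i)" using prod_cases3 by blast
    have "fst (R ! j) = c"
      using arg_cong[OF assms(4), of "\<lambda>l. l ! j"] j p horb_length[OF P] R by simp
    then show "map (map_prod (\<lambda>c. c) (uev act (hinv act P R))) P ! j = R ! j"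
      using hinv_nth(1)[OF P R j p] hinv_nth(2)[OF P R j p, of act] j p horb_length[OF P]
      by (simp add: uev_def group_act_cancel[OF assms(1)] prod_eq_iff)
  qed (use horb_length[OF P] R in simp)
  finally show ?thesis
    using hword_winv[OF assms(1), of "hinv act P R" w] assms(2) R by simp
qed

text \<open>The inverse arrow is represented by a reversed word for \<open>P\<close> acting on the
  unit state at the target \<delta>; reversing twice restores the word.\<close>

lemma hinv_hinv:
  assumes "P \<in> uorb \<gamma>" "map fst P = \<delta>"
  defines "Q \<equiv> hinv ushift P (ustate \<delta>)"
  shows "Q \<in> uorb \<delta>" "map fst Q = \<gamma>" "hinv ushift Q (ustate \<gamma>) = P"
proof -
  obtain w where w: "P = hword ushift w (ustate \<gamma>)" "valid_word (length \<gamma>) w"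
    using assms(1) by (auto simp: horb_def)
  have l: "length \<delta> = length \<gamma>" using horb_length[OF assms(1)] assms(2) by auto
  have Q: "Q = hword ushift (winv w) (ustate \<delta>)"
    unfolding Q_def using assms(2) by (intro hinv_hword[OF group_act_ushift w(2,1)]) simp
  then show "Q \<in> uorb \<delta>" using w(2) l unfolding horb_def by auto
  show 2: "map fst Q = \<gamma>"
    unfolding Q_def using fst_hinv_iff[OF assms(1), of "ustate \<delta>" ushift] assms(2) l by simp
  have "hinv ushift Q (ustate \<gamma>) = hword ushift (winv (winv w)) (ustate \<gamma>)"
    using w(2) l 2 by (intro hinv_hword[OF group_act_ushift _ Q]) simp_all
  then show "hinv ushift Q (ustate \<gamma>) = P" by (simp add: w(1))
qed

text \<open>Precomposition with \<open>P\<close> maps the morphisms out of its target onto those out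
  of its source, which gives one inequality; the inverse of \<open>P\<close> gives the
  other.\<close>

lemma card_uorb:
  fixes \<gamma> :: "'g::{group_add,finite} list"
  assumes "P \<in> uorb \<gamma>" "map fst P = \<delta>"
  shows "card (uorb \<gamma>) = card (uorb \<delta>)"
proof -
  have le: "card (uorb \<gamma>) \<le> card (uorb \<delta>)" if "P \<in> uorb \<gamma>" "map fst P = \<delta>"
    for P and \<gamma> \<delta> :: "'g list"
  proof -
    have "uorb \<gamma> = horb ushift P" using horb_eq[OF group_act_ushift that(1)] by simp
    also have "\<dots> = map (map_prod (\<lambda>c. c) (uev ushift P)) ` uorb \<delta>"
      using horb_map[OF equivariant_uev[OF group_act_ushift], of P "ustate (map fst P)"]
      unfolding map_uev_ustate[OF group_act_ushift] unfolding that(2) .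
    finally show ?thesis
      by (simp add: card_image_le finite_horb[OF group_act_ushift])
  qed
  show ?thesis using le[OF assms] le[OF hinv_hinv(1,2)[OF assms]] by simp
qed

text \<open>The left side is the shape braidization takes at degree \<gamma>: morphisms ending at
  \<gamma>, weighted by their sources. Inversion matches them with the morphisms starting at
  \<gamma>, and \<open>card_uorb\<close> makes the weights equal.\<close>

lemma sum_uorb_inverse:
  fixes \<gamma> :: "'g::{group_add,finite} list" and f :: "_ \<Rightarrow> 'k::field_char_0"
  shows "(\<Sum>\<delta>\<in>{\<delta>. length \<delta> = length \<gamma>}. 1 / of_nat (card (uorb \<delta>)) *
            (\<Sum>P\<in>uorb \<delta>. if map fst P = \<gamma> then f (hinv ushift P (ustate \<gamma>)) else 0))
    = (\<Sum>Q\<in>uorb \<gamma>. f Q) / of_nat (card (uorb \<gamma>))"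
proof -
  let ?Z = "SIGMA \<delta>:{\<delta>. length \<delta> = length \<gamma>}. {P \<in> uorb \<delta>. map fst P = \<gamma>}"
  have fin: "finite {\<delta>::'g list. length \<delta> = length \<gamma>}"
    using finite_lists_length_eq[of "UNIV :: 'g set"] by simp
  have fin': "finite (uorb \<delta>)" for \<delta> :: "'g list" by (rule finite_horb[OF group_act_ushift])
  have "(\<Sum>\<delta>\<in>{\<delta>. length \<delta> = length \<gamma>}. 1 / of_nat (card (uorb \<delta>)) *
            (\<Sum>P\<in>uorb \<delta>. if map fst P = \<gamma> then f (hinv ushift P (ustate \<gamma>)) else 0))
    = (\<Sum>\<delta>\<in>{\<delta>. length \<delta> = length \<gamma>}. \<Sum>P\<in>{P \<in> uorb \<delta>. map fst P = \<gamma>}.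
        f (hinv ushift P (ustate \<gamma>)) / of_nat (card (uorb \<gamma>)))"
  proof (intro sum.cong refl)
    fix \<delta> :: "'g list"
    have "1 / of_nat (card (uorb \<delta>)) *
            (\<Sum>P\<in>uorb \<delta>. if map fst P = \<gamma> then f (hinv ushift P (ustate \<gamma>)) else 0)
      = 1 / of_nat (card (uorb \<delta>)) * (\<Sum>P\<in>{P \<in> uorb \<delta>. map fst P = \<gamma>}. f (hinv ushift P (ustate \<gamma>)))"
      using fin' by (simp add: sum.inter_filter)
    also have "\<dots> = (\<Sum>P\<in>{P \<in> uorb \<delta>. map fst P = \<gamma>}.
        f (hinv ushift P (ustate \<gamma>)) / of_nat (card (uorb \<gamma>)))"
      unfolding sum_distrib_left by (intro sum.cong refl) (auto dest: card_uorb)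
    finally show "1 / of_nat (card (uorb \<delta>)) *
            (\<Sum>P\<in>uorb \<delta>. if map fst P = \<gamma> then f (hinv ushift P (ustate \<gamma>)) else 0)
      = (\<Sum>P\<in>{P \<in> uorb \<delta>. map fst P = \<gamma>}. f (hinv ushift P (ustate \<gamma>)) / of_nat (card (uorb \<gamma>)))" .
  qed
  also have "\<dots> = (\<Sum>(\<delta>, P)\<in>?Z. f (hinv ushift P (ustate \<gamma>)) / of_nat (card (uorb \<gamma>)))"
    using fin fin' by (intro sum.Sigma) auto
  also have "\<dots> = (\<Sum>Q\<in>uorb \<gamma>. f Q / of_nat (card (uorb \<gamma>)))"
  \<comment> \<open>The source \<delta> of the inverse of \<open>Q\<close> is the target
    \<open>map fst Q\<close> of \<open>Q\<close>.\<close>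
  proof (rule sum.reindex_bij_witness[where i = "\<lambda>Q. (map fst Q, hinv ushift Q (ustate (map fst Q)))"
        and j = "\<lambda>(\<delta>, P). hinv ushift P (ustate \<gamma>)"], goal_cases)
    case (1 z)
    obtain \<delta> P where z: "z = (\<delta>, P)" by fastforce
    then have "P \<in> uorb \<delta>" "map fst P = \<gamma>" using 1 by auto
    from hinv_hinv(2,3)[OF this] show ?case by (simp add: z)
  next
    case (2 z)
    obtain \<delta> P where z: "z = (\<delta>, P)" by fastforce
    then have "P \<in> uorb \<delta>" "map fst P = \<gamma>" using 2 by auto
    from hinv_hinv(1)[OF this] show ?case by (simp add: z)
  next
    case (3 Q)
    then show ?case using hinv_hinv(3)[OF 3 refl] by simp
  next
    case (4 Q)
    then show ?case using hinv_hinv(1,2)[OF 4 refl] horb_length[OF 4] by simp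
  qed auto
  finally show ?thesis by (simp add: sum_divide_distrib)
qed


section \<open>Multilinear forms on a graded module\<close>

text \<open>Multilinearity is separated by length because \<open>braidize\<close> and
  \<open>braid_act\<close> sum over a range that depends on the length of the argument, and a braid
  word is meaningful only on sufficiently many strands.\<close>

definition multilin_at :: "('k::field \<Rightarrow> 'h::ab_group_add \<Rightarrow> 'h) \<Rightarrow> nat \<Rightarrow> ('h list \<Rightarrow> 'k) \<Rightarrow> bool" where
  "multilin_at sc n F \<longleftrightarrow> (\<forall>vs i a b v w. length vs = n \<longrightarrow> i < n \<longrightarrow>
     F (vs[i := sc a v + sc b w]) = a * F (vs[i := v]) + b * F (vs[i := w]))"

lemma multilin_iff: "multilin sc F \<longleftrightarrow> (\<forall>n. multilin_at sc n F)"
proof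
  assume F: "multilin sc F"
  show "\<forall>n. multilin_at sc n F"
    using F by (auto simp: multilin_at_def multilin_def upd_conv_take_nth_drop)
next
  assume F: "\<forall>n. multilin_at sc n F"
  have "F (xs @ (sc a v + sc b w) # ys) = a * F (xs @ v # ys) + b * F (xs @ w # ys)" for xs ys a b v w
    using F[unfolded multilin_at_def, rule_format, where vs = "xs @ v # ys" and i = "length xs"
        and a = a and b = b and v = v and w = w]
    by simp
  then show "multilin sc F" by (simp add: multilin_def)
qed

lemma multilin_imp_at: "multilin sc F \<Longrightarrow> multilin_at sc n F"
  by (simp add: multilin_iff)

lemma multilin_atD:
  "multilin_at sc n F \<Longrightarrow> length vs = n \<Longrightarrow> i < n \<Longrightarrow>
    F (vs[i := sc a v + sc b w]) = a * F (vs[i := v]) + b * F (vs[i := w])"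
  by (simp add: multilin_at_def)

lemma multilin_at_cong:
  "(\<And>vs. length vs = n \<Longrightarrow> F vs = F' vs) \<Longrightarrow> multilin_at sc n F \<longleftrightarrow> multilin_at sc n F'"
  by (simp add: multilin_at_def)

lemma multilin_at_mult: "multilin_at sc n F \<Longrightarrow> multilin_at sc n (\<lambda>vs. a * F vs)"
  by (simp add: multilin_at_def algebra_simps)

lemma multilin_at_add:
  "multilin_at sc n F \<Longrightarrow> multilin_at sc n F' \<Longrightarrow> multilin_at sc n (\<lambda>vs. F vs + F' vs)"
  by (simp add: multilin_at_def algebra_simps)

lemma multilin_at_sum:
  "(\<And>i. i \<in> I \<Longrightarrow> multilin_at sc n (f i)) \<Longrightarrow> multilin_at sc n (\<lambda>vs. \<Sum>i\<in>I. f i vs)"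
  by (simp add: multilin_at_def sum.distrib sum_distrib_left)

lemma multilin_juxt:
  fixes sc :: "'k::field \<Rightarrow> 'h::ab_group_add \<Rightarrow> 'h"
  assumes "multilin sc F" "multilin sc G"
  shows "multilin sc (juxt F G)"
  unfolding multilin_iff
proof
  fix n
  have "multilin_at sc n (\<lambda>vs. F (take k vs) * G (drop k vs))" if "k \<le> n" for k
    unfolding multilin_at_def
  proof (intro allI impI)
    fix vs :: "'h list" and i a b v w assume vs: "length vs = n" "i < n"
    show "F (take k (vs[i := sc a v + sc b w])) * G (drop k (vs[i := sc a v + sc b w]))
      = a * (F (take k (vs[i := v])) * G (drop k (vs[i := v])))
      + b * (F (take k (vs[i := w])) * G (drop k (vs[i := w])))"
    proof (cases "i < k")
      case True
      then show ?thesis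
        using multilin_atD[OF multilin_imp_at[OF assms(1)], of "take k vs" k i] vs that
        by (simp add: take_update_swap algebra_simps)
    next
      case False
      then show ?thesis
        using multilin_atD[OF multilin_imp_at[OF assms(2)], of "drop k vs" "n - k" "i - k"] vs that
        by (simp add: drop_update_swap algebra_simps)
    qed
  qed
  then have "multilin_at sc n (\<lambda>vs. \<Sum>k\<le>n. F (take k vs) * G (drop k vs))"
    by (intro multilin_at_sum) auto
  then show "multilin_at sc n (juxt F G)"
    by (subst multilin_at_cong[where F' = "\<lambda>vs. \<Sum>k\<le>n. F (take k vs) * G (drop k vs)"])
      (simp_all add: juxt_def)
qed

lemma multilin_unit1: "multilin sc unit1"
  by (simp add: multilin_def unit1_def)

lemma juxt_unit1: "juxt unit1 F = F" "juxt F unit1 = F"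
proof -
  show "juxt unit1 F = F"
  proof
    fix vs
    have "juxt unit1 F vs = (\<Sum>k\<le>length vs. if k = 0 then F vs else 0)"
      unfolding juxt_def by (intro sum.cong) (auto simp: unit1_def)
    then show "juxt unit1 F vs = F vs" by (simp add: sum.delta)
  qed
  show "juxt F unit1 = F"
  proof
    fix vs
    have "juxt F unit1 vs = (\<Sum>k\<le>length vs. if k = length vs then F vs else 0)"
      unfolding juxt_def by (intro sum.cong) (auto simp: unit1_def)
    then show "juxt F unit1 vs = F vs" by (simp add: sum.delta)
  qed
qed

lemma juxt_assoc: "juxt (juxt F G) E = juxt F (juxt G E)"
proof
  fix vs :: "'a list"
  let ?n = "length vs"
  have "juxt (juxt F G) E vs
    = (\<Sum>k\<le>?n. \<Sum>l\<le>k. F (take l vs) * G (drop l (take k vs)) * E (drop k vs))"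
    unfolding juxt_def
    by (intro sum.cong refl) (auto simp: sum_distrib_right min_def intro!: sum.cong)
  also have "\<dots> = (\<Sum>(k, l)\<in>(SIGMA k:{..?n}. {..k}). F (take l vs) * G (drop l (take k vs)) * E (drop k vs))"
    by (intro sum.Sigma) auto
  \<comment> \<open>Two cut points \<open>l\<close> \<le> \<open>k\<close> are replaced by the first
    cut and the length \<open>j = k - l\<close> of the middle piece.\<close>
  also have "\<dots> = (\<Sum>(l, j)\<in>(SIGMA l:{..?n}. {..?n - l}). F (take l vs) * G (take j (drop l vs)) * E (drop j (drop l vs)))"
    by (rule sum.reindex_bij_witness[where i = "\<lambda>(l, j). (l + j, l)" and j = "\<lambda>(k, l). (l, k - l)"])
      (auto simp: drop_take)
  also have "\<dots> = (\<Sum>l\<le>?n. \<Sum>j\<le>?n - l. F (take l vs) * G (take j (drop l vs)) * E (drop j (drop l vs)))"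
    by (intro sum.Sigma[symmetric]) auto
  also have "\<dots> = juxt F (juxt G E) vs"
    unfolding juxt_def by (simp add: sum_distrib_left mult.assoc)
  finally show "juxt (juxt F G) E vs = juxt F (juxt G E) vs" .
qed

lemma gsact_mor_of:
  assumes "P \<in> uorb \<gamma>" "length R = length \<gamma>"
  shows "gsact act (mor_of P) F (map snd R) = F (map snd (hinv act P R))"
proof -
  have bij: "bij_betw (\<lambda>j. map (snd \<circ> snd) P ! j) {..<length \<gamma>} {..<length \<gamma>}"
    by (rule uorb_bij[OF assms(1)])
  have "map (\<lambda>i. let j = the_inv_into {..<length \<gamma>} (\<lambda>j. snd (mor_of P) ! j) i
        in act (- (fst (mor_of P) ! j)) (map snd R ! j)) [0..<length \<gamma>]
      = map snd (hinv act P R)"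
    unfolding hinv_def map_map assms(2)
  proof (rule map_cong[OF refl])
    fix i assume "i \<in> set [0..<length \<gamma>]"
    then have "the_inv_into {..<length \<gamma>} (\<lambda>j. map (snd \<circ> snd) P ! j) i \<in> {..<length \<gamma>}"
      using bij by (intro the_inv_into_into) (auto simp: bij_betw_def)
    then show "(let j = the_inv_into {..<length \<gamma>} (\<lambda>j. snd (mor_of P) ! j) i
        in act (- (fst (mor_of P) ! j)) (map snd R ! j))
      = (snd \<circ> (\<lambda>i. let j = the_inv_into {..<length \<gamma>} (\<lambda>j. map (snd \<circ> snd) P ! j) i; g = fst (snd (P ! j))
          in (- g + fst (R ! j) + g, act (- g) (snd (R ! j))))) i"
      using horb_length[OF assms(1)] assms(2) by (simp add: mor_of_def Let_def)
  qed
  then show ?thesis by (simp add: gsact_def assms(2))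
qed

locale graded_module =
  fixes sc :: "'k::field_char_0 \<Rightarrow> 'h::ab_group_add \<Rightarrow> 'h"
    and Hg :: "'g::{group_add,finite} \<Rightarrow> 'h set"
    and act :: "'g \<Rightarrow> 'h \<Rightarrow> 'h"
  assumes gg: "ggmod sc Hg act"
begin

sublocale V: vector_space sc
  using gg by (simp add: ggmod_def)

lemma group_act: "group_act act"
  using gg by (simp add: ggmod_def group_act_def)

lemma act_lin: "act g (sc a v + sc b w) = sc a (act g v) + sc b (act g w)"
proof -
  have "Vector_Spaces.linear sc sc (act g)" using gg by (simp add: ggmod_def)
  then interpret L: Vector_Spaces.linear sc sc "act g" .
  show ?thesis by (simp add: L.add L.scale)
qed

lemma act_degree: "v \<in> Hg m \<Longrightarrow> act g v \<in> Hg (g + m - g)"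
  using gg unfolding ggmod_def by blast

lemma Hg_subspace: "V.subspace (Hg m)"
  using gg by (simp add: ggmod_def)

lemma decomposition: "\<exists>!c. (\<forall>m. c m \<in> Hg m) \<and> v = (\<Sum>m\<in>UNIV. c m)"
  using gg by (simp add: ggmod_def)

lemma gproj_unique:
  assumes "\<And>m. c m \<in> Hg m" "v = (\<Sum>m\<in>UNIV. c m)"
  shows "gproj Hg m v = c m"
proof -
  have "(THE c. (\<forall>m. c m \<in> Hg m) \<and> v = (\<Sum>m\<in>UNIV. c m)) = c"
    by (rule the1_equality[OF decomposition]) (use assms in auto)
  then show ?thesis by (simp add: gproj_def)
qed

lemma gproj_in: "gproj Hg m v \<in> Hg m"
  and gproj_sum: "(\<Sum>m\<in>UNIV. gproj Hg m v) = v"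
  using theI'[OF decomposition[of v]] by (simp_all add: gproj_def)

lemma gproj_lin: "gproj Hg m (sc a v + sc b w) = sc a (gproj Hg m v) + sc b (gproj Hg m w)"
proof (rule gproj_unique)
  show "sc a (gproj Hg m v) + sc b (gproj Hg m w) \<in> Hg m" for m
    using gproj_in Hg_subspace by (simp add: V.subspace_add V.subspace_scale)
  show "sc a v + sc b w = (\<Sum>m\<in>UNIV. sc a (gproj Hg m v) + sc b (gproj Hg m w))"
    by (simp add: sum.distrib gproj_sum flip: V.scale_sum_right)
qed

lemma gproj_homogeneous: "v \<in> Hg m \<Longrightarrow> gproj Hg m' v = (if m' = m then v else 0)"
  by (rule gproj_unique) (auto simp: V.subspace_0[OF Hg_subspace])

lemma multilin_at_zero:
  assumes "multilin_at sc n F" "length vs = n" "i < n" "vs ! i = 0"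
  shows "F vs = 0"
  using multilin_atD[OF assms(1-3), of 0 0 0 0] assms by (metis V.scale_zero_left add_0 list_update_id mult_zero_left)

lemma multilin_at_update_sum:
  assumes "multilin_at sc n F" "length vs = n" "i < n"
  shows "F (vs[i := (\<Sum>m\<in>A. c m)]) = (\<Sum>m\<in>A. F (vs[i := c m]))"
proof (induction A rule: infinite_finite_induct)
  case (insert x A)
  then show ?case using multilin_atD[OF assms, of 1 "c x" 1 "\<Sum>m\<in>A. c m"] by simp
qed (use assms multilin_at_zero[OF assms(1)] in auto)

text \<open>A list of pairs \<open>(c, v)\<close> with \<open>v\<close> homogeneous; \<open>c\<close> is the degree of the forms that do not
  vanish on \<open>v\<close>, i.e. the inverse of the degree of \<open>v\<close>.\<close>

definition homs :: "('g \<times> 'h) list \<Rightarrow> bool" where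
  "homs R \<longleftrightarrow> (\<forall>p\<in>set R. snd p \<in> Hg (- fst p))"

lemma homs_simps [simp]: "homs []" "homs (p # R) \<longleftrightarrow> snd p \<in> Hg (- fst p) \<and> homs R"
  "homs (R @ R') \<longleftrightarrow> homs R \<and> homs R'"
  by (auto simp: homs_def)

lemma homs_take: "homs R \<Longrightarrow> homs (take k R)" and homs_drop: "homs R \<Longrightarrow> homs (drop k R)"
  by (auto simp: homs_def dest: in_set_takeD in_set_dropD)

lemma act_dual_degree: "v \<in> Hg (- c) \<Longrightarrow> act g v \<in> Hg (- (g + c - g))"
  using act_degree[of v "- c" g]
  by (simp add: minus_add add.assoc diff_conv_add_uminus del: add_uminus_conv_diff)

lemma homs_horb:
  assumes "homs R" "T \<in> horb act R"
  shows "homs T"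
proof -
  obtain w where w: "T = hword act w R" "valid_word (length R) w"
    using assms(2) by (auto simp: horb_def)
  show ?thesis
    unfolding w(1)
  proof (rule hword_invariant[OF w(2)])
    fix P Q p q b assume "homs (P @ p # q # Q)"
    then show "homs (P @ hcross act b p q @ Q)"
      using act_dual_degree[of "snd q" "fst q" "fst p"] act_dual_degree[of "snd p" "fst p" "- fst q"]
      by (cases b; cases p; cases q) auto
  qed (rule assms(1))
qed

text \<open>Homogeneous vectors span, so the entries can be expanded one by one from the left;
  \<open>R\<close> is the prefix already made homogeneous.\<close>

lemma multilin_at_ext:
  assumes F: "multilin_at sc n F" "multilin_at sc n F'" "length vs = n"
    and eq: "\<And>R. homs R \<Longrightarrow> length R = n \<Longrightarrow> F (map snd R) = F' (map snd R)"
  shows "F vs = F' vs"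
proof -
  have "F (map snd R @ ys) = F' (map snd R @ ys)" if "homs R" "length R + length ys = n" for R ys
    using that
  proof (induction ys arbitrary: R)
    case Nil
    then show ?case using eq by simp
  next
    case (Cons v ys)
    \<comment> \<open>The component of degree \<open>m\<close> gets the label \<open>- m\<close>,
      the degree of the forms that see it.\<close>
    have *: "E (map snd R @ v # ys) = (\<Sum>m\<in>UNIV. E (map snd (R @ [(- m, gproj Hg m v)]) @ ys))"
      if "multilin_at sc n E" for E :: "'h list \<Rightarrow> 'k"
      using multilin_at_update_sum[OF that, of "map snd R @ v # ys" "length R" "\<lambda>m. gproj Hg m v" UNIV]
        Cons.prems(2)
      by (simp add: gproj_sum list_update_append)
    have "F (map snd (R @ [(- m, gproj Hg m v)]) @ ys) = F' (map snd (R @ [(- m, gproj Hg m v)]) @ ys)" for m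
      using Cons.prems gproj_in by (intro Cons.IH) auto
    then show ?case by (simp only: *[OF F(1)] *[OF F(2)])
  qed
  from this[of "[]" vs] show ?thesis using F(3) by simp
qed

lemma multilin_ext:
  assumes "multilin sc F" "multilin sc F'" "\<And>R. homs R \<Longrightarrow> F (map snd R) = F' (map snd R)"
  shows "F = F'"
  using assms multilin_at_ext[of _ F F'] by (auto simp: multilin_iff)

section \<open>Braid operators preserve multilinearity\<close>

lemma multilin_at_hcomp:
  assumes "multilin_at sc n F"
  shows "multilin_at sc n (hcomp Hg \<gamma> F)"
proof (cases "length \<gamma> = n")
  case True
  let ?p = "\<lambda>c v. gproj Hg (- c) v"
  have "hcomp Hg \<gamma> F (vs[i := x]) = F ((map2 ?p \<gamma> vs)[i := ?p (\<gamma> ! i) x])"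
    if "length vs = n" "i < n" for vs i x
  proof -
    have "map2 ?p \<gamma> (vs[i := x]) = (map2 ?p \<gamma> vs)[i := ?p (\<gamma> ! i) x]"
      using that True by (intro nth_equalityI) (auto simp: nth_list_update)
    then show ?thesis using that True by (simp add: hcomp_def)
  qed
  then show ?thesis
    using True multilin_atD[OF assms] by (simp add: multilin_at_def gproj_lin)
next
  case False
  then show ?thesis by (simp add: multilin_at_def hcomp_def)
qed

text \<open>The arguments are permuted and each is moved linearly, so changing one argument changes
  exactly one argument of \<open>F\<close>. The degrees in \<open>zip\<close> only fill the label
  slot: the vectors in \<open>hinv\<close> do not depend on them.\<close>

lemma multilin_at_gsact:
  assumes "multilin_at sc n F" "P \<in> uorb \<gamma>" "length \<gamma> = n"
  shows "multilin_at sc n (gsact act (mor_of P) F)"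
proof -
  have upd: "gsact act (mor_of P) F (vs[i := x])
      = F ((map snd (hinv act P (zip \<gamma> vs)))[snd (snd (P ! i)) := act (- fst (snd (P ! i))) x])"
    and lt: "snd (snd (P ! i)) < n"
    if vs: "length vs = n" "i < n" for vs i x
  proof -
    obtain c g k where p: "P ! i = (c, g, k)" using prod_cases3 by blast
    have i: "i < length \<gamma>" using vs assms(3) by simp
    have k: "k < n" using hinv_nth(1)[OF assms(2) _ i p, of "zip \<gamma> vs"] vs assms(3) by simp
    then show "snd (snd (P ! i)) < n" using p by simp
    have "map snd (hinv act P (zip \<gamma> (vs[i := x]))) = (map snd (hinv act P (zip \<gamma> vs)))[k := act (- g) x]"
    proof (rule nth_equalityI)
      fix k' assume "k' < length (map snd (hinv act P (zip \<gamma> (vs[i := x]))))"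
      then have k': "k' < length \<gamma>" using vs assms(3) by simp
      obtain j c' g' where j: "j < length \<gamma>" "P ! j = (c', g', k')"
        using hinv_nth_ex[OF assms(2) k'] by blast
      \<comment> \<open>Injectivity of the permutation: position \<open>k\<close> receives only
        argument \<open>i\<close>.\<close>
      have "k = k' \<Longrightarrow> i = j"
        using uorb_bij[OF assms(2)] i j p horb_length[OF assms(2)]
        by (auto simp: bij_betw_def inj_on_def)
      then show "map snd (hinv act P (zip \<gamma> (vs[i := x]))) ! k'
          = (map snd (hinv act P (zip \<gamma> vs)))[k := act (- g) x] ! k'"
        using hinv_nth(2)[OF assms(2) _ j, of "zip \<gamma> vs"] hinv_nth(2)[OF assms(2) _ j, of "zip \<gamma> (vs[i := x])"]
          j k k' p vs assms(3)
        by (auto simp: nth_list_update)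
    qed (use vs assms(3) in simp)
    then show "gsact act (mor_of P) F (vs[i := x])
      = F ((map snd (hinv act P (zip \<gamma> vs)))[snd (snd (P ! i)) := act (- fst (snd (P ! i))) x])"
      using gsact_mor_of[OF assms(2), of "zip \<gamma> (vs[i := x])" act F] vs assms(3) p by simp
  qed
  show ?thesis
    unfolding multilin_at_def
  proof (intro allI impI)
    fix vs :: "'h list" and i a b v w assume vs: "length vs = n" "i < n"
    show "gsact act (mor_of P) F (vs[i := sc a v + sc b w])
      = a * gsact act (mor_of P) F (vs[i := v]) + b * gsact act (mor_of P) F (vs[i := w])"
      unfolding upd[OF vs] act_lin
      using vs assms(3) lt[OF vs] by (intro multilin_atD[OF assms(1)]) simp_all
  qed
qed

lemma finite_degrees: "finite {\<gamma>::'g list. length \<gamma> = n}"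
  using finite_lists_length_eq[of "UNIV :: 'g set" n] by simp

lemma multilin_braidize:
  assumes "multilin sc F"
  shows "multilin sc (braidize Hg act F)"
  unfolding multilin_iff
proof
  fix n
  let ?f = "\<lambda>vs. \<Sum>\<gamma>\<in>{\<gamma>. length \<gamma> = n}. (1 / of_nat (card (Aset \<gamma>))) * (\<Sum>a\<in>Aset \<gamma>. gsact act a (hcomp Hg \<gamma> F) vs)"
  have "multilin_at sc n ?f"
    using multilin_at_gsact[OF multilin_at_hcomp[OF multilin_imp_at[OF assms]]]
    by (intro multilin_at_sum multilin_at_mult) (auto simp: Aset_uorb)
  then show "multilin_at sc n (braidize Hg act F)"
    by (subst multilin_at_cong[where F' = ?f]) (simp_all add: braidize_def)
qed

lemma multilin_at_braid_act:
  assumes "multilin_at sc n F" "valid_word n w"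
  shows "multilin_at sc n (braid_act Hg act w F)"
proof -
  let ?f = "\<lambda>vs. \<Sum>\<gamma>\<in>{\<gamma>. length \<gamma> = n}. gsact act (snd (bword w \<gamma>)) (hcomp Hg \<gamma> F) vs"
  have "multilin_at sc n (gsact act (snd (bword w \<gamma>)) (hcomp Hg \<gamma> F))" if "length \<gamma> = n" for \<gamma>
  proof -
    have "hword ushift w (ustate \<gamma>) \<in> uorb \<gamma>" using assms(2) that by (auto simp: horb_def)
    from multilin_at_gsact[OF multilin_at_hcomp[OF assms(1)] this that] show ?thesis
      using bword_ustate[of \<gamma> w] assms(2) that by simp
  qed
  then have "multilin_at sc n ?f" by (intro multilin_at_sum) simp
  then show ?thesis
    by (subst multilin_at_cong[where F' = ?f]) (simp_all add: braid_act_def)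
qed

section \<open>Braidization and invariance on homogeneous vectors\<close>

lemma hcomp_homs:
  assumes "multilin sc F" "homs R"
  shows "hcomp Hg \<gamma> F (map snd R) = (if map fst R = \<gamma> then F (map snd R) else 0)"
proof (cases "length R = length \<gamma>")
  case True
  let ?l = "map2 (\<lambda>c v. gproj Hg (- c) v) \<gamma> (map snd R)"
  have nth: "?l ! i = (if \<gamma> ! i = fst (R ! i) then snd (R ! i) else 0)" if "i < length \<gamma>" for i
    using that True assms(2) gproj_homogeneous[of "snd (R ! i)" "- fst (R ! i)" "- (\<gamma> ! i)"]
    by (auto simp: homs_def)
  show ?thesis
  proof (cases "map fst R = \<gamma>")
    case eq: True
    have "?l = map snd R"
    proof (rule nth_equalityI)
      fix i assume "i < length ?l"
      then have i: "i < length \<gamma>" "i < length R" using True by simp_all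
      then have "\<gamma> ! i = fst (R ! i)" by (simp flip: eq)
      then show "?l ! i = map snd R ! i" unfolding nth[OF i(1)] using i(2) by simp
    qed (use True in simp)
    then show ?thesis using eq True by (simp add: hcomp_def)
  next
    case False
    then obtain i where i: "i < length \<gamma>" "\<gamma> ! i \<noteq> fst (R ! i)"
      using True by (metis length_map nth_equalityI nth_map)
    \<comment> \<open>An entry of the wrong degree is projected to zero, and a multilinear form
      vanishes there.\<close>
    have "F ?l = 0"
      by (rule multilin_at_zero[OF multilin_imp_at[OF assms(1)], of _ _ i]) (use i True nth[OF i(1)] in auto)
    then show ?thesis using False by (simp add: hcomp_def)
  qed
qed (auto simp: hcomp_def)

lemma homs_hinv:
  assumes "homs R" "P \<in> uorb \<gamma>" "length R = length \<gamma>"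
  shows "homs (hinv act P R)"
  unfolding homs_def
proof
  fix p assume "p \<in> set (hinv act P R)"
  then obtain i where i: "i < length \<gamma>" "p = hinv act P R ! i"
    using assms(3) by (auto simp: in_set_conv_nth)
  obtain j c g where j: "j < length \<gamma>" "P ! j = (c, g, i)"
    using hinv_nth_ex[OF assms(2) i(1)] by blast
  have "snd (R ! j) \<in> Hg (- fst (R ! j))" using assms(1,3) j(1) by (simp add: homs_def)
  then show "snd p \<in> Hg (- fst p)"
    using hinv_nth(2)[OF assms(2,3) j, of act] act_dual_degree[of _ _ "- g"] i(2) by auto
qed

lemma gsact_hcomp:
  assumes "multilin sc F" "homs R" "P \<in> uorb \<gamma>" "length R = length \<gamma>"
  shows "gsact act (mor_of P) (hcomp Hg \<gamma> F) (map snd R)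
    = (if map fst P = map fst R then F (map snd (hinv act P R)) else 0)"
  using hcomp_homs[OF assms(1) homs_hinv[OF assms(2-4)]] gsact_mor_of[OF assms(3,4), of act "hcomp Hg \<gamma> F"]
    fst_hinv_iff[OF assms(3,4), of act]
  by simp

text \<open>Of all source degrees in the sum exactly one survives, the one that \<open>w\<close>
  carries to the degrees of \<open>R\<close>.\<close>

lemma braid_act_homs:
  assumes "multilin sc F" "homs R" "valid_word (length R) w"
  shows "braid_act Hg act w F (map snd R) = F (map snd (hword act (winv w) R))"
proof -
  let ?S = "hword act (winv w) R"
  have "gsact act (snd (bword w \<gamma>)) (hcomp Hg \<gamma> F) (map snd R)
      = (if \<gamma> = map fst ?S then F (map snd ?S) else 0)" if "length \<gamma> = length R" for \<gamma>
  proof -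
    define P where "P = hword ushift w (ustate \<gamma>)"
    have w: "valid_word (length \<gamma>) w" using assms(3) that by simp
    have P: "P \<in> uorb \<gamma>" using w by (auto simp: horb_def P_def)
    have 1: "gsact act (snd (bword w \<gamma>)) (hcomp Hg \<gamma> F) (map snd R)
        = (if map fst P = map fst R then F (map snd (hinv act P R)) else 0)"
      using gsact_hcomp[OF assms(1,2) P] bword_ustate[OF w] that by (simp add: P_def)
    have "map fst P = map fst R \<Longrightarrow> hinv act P R = ?S"
      by (rule hinv_hword[OF group_act w P_def])
    moreover have "map fst P = map fst R \<longleftrightarrow> \<gamma> = map fst ?S"
    proof
      assume eq: "map fst P = map fst R"
      then show "\<gamma> = map fst ?S"
        using fst_hinv_iff[OF P, of R act] that hinv_hword[OF group_act w P_def eq] by simp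
    next
      assume "\<gamma> = map fst ?S"
      then have "map fst P = map fst (hword act w ?S)"
        using fst_hword[OF group_act, of ?S w] assms(3) by (simp add: P_def)
      then show "map fst P = map fst R"
        using hword_winv'[OF group_act assms(3)] by simp
    qed
    ultimately show ?thesis using 1 by simp
  qed
  then have "braid_act Hg act w F (map snd R)
      = (\<Sum>\<gamma>\<in>{\<gamma>. length \<gamma> = length R}. if \<gamma> = map fst ?S then F (map snd ?S) else 0)"
    by (simp add: braid_act_def)
  then show ?thesis using assms(3) finite_degrees by (simp add: sum.delta')
qed

lemma braidize_homs:
  assumes "multilin sc F" "homs R"
  shows "braidize Hg act F (map snd R) = hav act (\<lambda>T. F (map snd T)) R"
proof -
  let ?\<gamma> = "map fst R"
  let ?e = "map (map_prod (\<lambda>c. c) (uev act R))"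
  have inner: "gsact act (mor_of P) (hcomp Hg \<delta> F) (map snd R)
      = (if map fst P = ?\<gamma> then F (map snd (?e (hinv ushift P (ustate ?\<gamma>)))) else 0)"
    if P: "P \<in> uorb \<delta>" and l: "length \<delta> = length R" for \<delta> P
  proof (cases "map fst P = ?\<gamma>")
    case True
    obtain w where w: "P = hword ushift w (ustate \<delta>)" "valid_word (length \<delta>) w"
      using P by (auto simp: horb_def)
    have "hinv act P R = hword act (winv w) R"
      by (rule hinv_hword[OF group_act w(2,1) True])
    moreover have "hinv ushift P (ustate ?\<gamma>) = hword ushift (winv w) (ustate ?\<gamma>)"
      by (rule hinv_hword[OF group_act_ushift w(2,1)]) (simp add: True)
    moreover have "hword act (winv w) R = ?e (hword ushift (winv w) (ustate ?\<gamma>))"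
      using hword_uev[OF group_act, of R "winv w"] w(2) l by simp
    ultimately show ?thesis using gsact_hcomp[OF assms P] l by simp
  next
    case False
    then show ?thesis using gsact_hcomp[OF assms P] l by simp
  qed
  have "braidize Hg act F (map snd R)
    = (\<Sum>\<delta>\<in>{\<delta>. length \<delta> = length R}. 1 / of_nat (card (uorb \<delta>)) *
          (\<Sum>P\<in>uorb \<delta>. gsact act (mor_of P) (hcomp Hg \<delta> F) (map snd R)))"
    by (simp add: braidize_def Aset_uorb sum.reindex[OF inj_on_mor_of] card_image[OF inj_on_mor_of])
  also have "\<dots> = (\<Sum>\<delta>\<in>{\<delta>. length \<delta> = length ?\<gamma>}. 1 / of_nat (card (uorb \<delta>)) *
          (\<Sum>P\<in>uorb \<delta>. if map fst P = ?\<gamma> then F (map snd (?e (hinv ushift P (ustate ?\<gamma>)))) else 0))"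
    using inner by (intro sum.cong refl arg_cong2[where f = "(*)"]) auto
  \<comment> \<open>Incoming morphisms are traded for outgoing ones.\<close>
  also have "\<dots> = hav ushift (\<lambda>Q. F (map snd (?e Q))) (ustate ?\<gamma>)"
    unfolding hav_def by (rule sum_uorb_inverse)
  \<comment> \<open>The evaluation map at \<open>R\<close> may identify morphisms; its uniform
    fibres leave the average unchanged.\<close>
  also have "\<dots> = hav act (\<lambda>T. F (map snd T)) R"
    using hav_map[OF equivariant_uev[OF group_act, of R] group_act_ushift group_act,
        of "\<lambda>T. F (map snd T)" "ustate ?\<gamma>"]
    by (simp add: map_uev_ustate[OF group_act])
  finally show ?thesis .
qed

text \<open>Words act on forms through \<open>winv\<close>, and the valid words are closed under
  \<open>winv\<close>, so invariance under all words is constancy on orbits.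
  \<open>multilin_at_ext\<close> extends this from homogeneous to arbitrary lists.\<close>

lemma Br_iff:
  "F \<in> Br sc Hg act \<longleftrightarrow> multilin sc F \<and>
    (\<forall>R. homs R \<longrightarrow> (\<forall>T\<in>horb act R. F (map snd T) = F (map snd R)))"
proof (cases "multilin sc F")
  case True
  show ?thesis
  proof
    assume "F \<in> Br sc Hg act"
    then have inv: "\<And>w vs. valid_word (length vs) w \<Longrightarrow> braid_act Hg act w F vs = F vs"
      by (simp add: Br_def)
    have "F (map snd (hword act w R)) = F (map snd R)" if "homs R" "valid_word (length R) w" for R w
      using braid_act_homs[OF True that(1), of "winv w"] inv[of "map snd R" "winv w"] that(2) by simp
    then show "multilin sc F \<and> (\<forall>R. homs R \<longrightarrow> (\<forall>T\<in>horb act R. F (map snd T) = F (map snd R)))"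
      using True by (auto simp: horb_def)
  next
    assume "multilin sc F \<and> (\<forall>R. homs R \<longrightarrow> (\<forall>T\<in>horb act R. F (map snd T) = F (map snd R)))"
    then have inv: "\<And>R w. homs R \<Longrightarrow> valid_word (length R) w \<Longrightarrow> F (map snd (hword act w R)) = F (map snd R)"
      by (auto simp: horb_def)
    have "braid_act Hg act w F vs = F vs" if "valid_word (length vs) w" for w vs
      by (rule multilin_at_ext[OF multilin_at_braid_act[OF multilin_imp_at[OF True] that] multilin_imp_at[OF True]])
        (use that inv braid_act_homs[OF True] in auto)
    then show "F \<in> Br sc Hg act" using True by (simp add: Br_def)
  qed
qed (simp add: Br_def)

end


section \<open>The braided algebra\<close>

context graded_module
begin

lemma multilin_dact:
  assumes "multilin sc F"
  shows "multilin sc (dact act g F)"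
  using assms by (simp add: multilin_def dact_def act_lin)

lemma multilin_dcomp:
  assumes "multilin sc F"
  shows "multilin sc (dcomp Hg g F)"
  unfolding multilin_iff
proof
  fix n
  let ?f = "\<lambda>vs. \<Sum>\<gamma>\<in>{\<gamma>. length \<gamma> = n \<and> sum_list \<gamma> = g}. hcomp Hg \<gamma> F vs"
  have "multilin_at sc n ?f"
    by (intro multilin_at_sum multilin_at_hcomp multilin_imp_at assms)
  then show "multilin_at sc n (dcomp Hg g F)"
    by (subst multilin_at_cong[where F' = ?f]) (simp_all add: dcomp_def)
qed

lemma multilin_circ: "multilin sc F \<Longrightarrow> multilin sc G \<Longrightarrow> multilin sc (circ Hg act F G)"
  unfolding circ_def by (intro multilin_braidize multilin_juxt)

lemma Br_multilin: "F \<in> Br sc Hg act \<Longrightarrow> multilin sc F"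
  by (simp add: Br_def)

lemma Br_orbit:
  "F \<in> Br sc Hg act \<Longrightarrow> homs R \<Longrightarrow> T \<in> horb act R \<Longrightarrow> F (map snd T) = F (map snd R)"
  unfolding Br_iff by blast

lemma BrI:
  assumes "multilin sc F" "\<And>R T. homs R \<Longrightarrow> T \<in> horb act R \<Longrightarrow> F (map snd T) = F (map snd R)"
  shows "F \<in> Br sc Hg act"
  using assms unfolding Br_iff by blast

text \<open>The action of the inverse of \<open>g\<close>, as in the dual module: evaluating the
  translate of a form by \<open>g\<close> moves the arguments by \<open>- g\<close>, and conjugating
  the labels keeps the list homogeneous.\<close>

definition conjmap :: "'g \<Rightarrow> ('g \<times> 'h) list \<Rightarrow> ('g \<times> 'h) list" where
  "conjmap g = map (map_prod (\<lambda>c. - g + c + g) (act (- g)))"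

lemma equivariant_conj: "equivariant act act (\<lambda>c. - g + c + g) (act (- g))"
proof -
  have "act (- g) (act c x) = act (- g + c + g) (act (- g) x)" for c x
    by (simp flip: group_act_add[OF group_act])
  then show ?thesis
    unfolding equivariant_def by (simp add: add.assoc)
qed

lemma homs_conjmap: "homs R \<Longrightarrow> homs (conjmap g R)"
  using act_dual_degree[of _ _ "- g"] by (auto simp: homs_def conjmap_def)

lemma dact_homs: "dact act g F (map snd R) = F (map snd (conjmap g R))"
  by (simp add: dact_def conjmap_def o_def snd_map_prod)

lemma dcomp_homs:
  assumes "multilin sc F" "homs R"
  shows "dcomp Hg g F (map snd R) = (if sum_list (map fst R) = g then F (map snd R) else 0)"
proof -
  have "finite {\<gamma>::'g list. length \<gamma> = length R \<and> sum_list \<gamma> = g}"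
    using finite_degrees[of "length R"] by (rule rev_finite_subset) auto
  then show ?thesis by (simp add: dcomp_def hcomp_homs[OF assms] sum.delta)
qed

lemma sum_list_horb: "T \<in> horb act R \<Longrightarrow> sum_list (map fst T) = sum_list (map fst R)"
  by (auto simp: horb_def sum_list_hword)

lemma braidize_in_Br:
  assumes "multilin sc F"
  shows "braidize Hg act F \<in> Br sc Hg act"
proof (rule BrI[OF multilin_braidize[OF assms]])
  fix R T assume "homs R" "T \<in> horb act R"
  then show "braidize Hg act F (map snd T) = braidize Hg act F (map snd R)"
    by (simp add: braidize_homs[OF assms] homs_horb[of R] hav_orbit[OF group_act])
qed

lemma braidize_Br:
  assumes "F \<in> Br sc Hg act"
  shows "braidize Hg act F = F"
proof (rule multilin_ext)
  show F: "multilin sc F" using assms by (rule Br_multilin)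
  then show "multilin sc (braidize Hg act F)" by (rule multilin_braidize)
  fix R assume R: "homs R"
  show "braidize Hg act F (map snd R) = F (map snd R)"
    unfolding braidize_homs[OF F R] by (rule hav_const[OF group_act Br_orbit[OF assms R]])
qed

section \<open>Closure of the invariant forms and linearity of braidization\<close>

lemma Br_add:
  assumes "F \<in> Br sc Hg act" "G \<in> Br sc Hg act"
  shows "(\<lambda>vs. F vs + G vs) \<in> Br sc Hg act"
proof (rule BrI)
  show "multilin sc (\<lambda>vs. F vs + G vs)"
    using assms[THEN Br_multilin] by (simp add: multilin_iff multilin_at_add)
  fix R T assume R: "homs R" "T \<in> horb act R"
  show "F (map snd T) + G (map snd T) = F (map snd R) + G (map snd R)"
    by (simp only: Br_orbit[OF assms(1) R] Br_orbit[OF assms(2) R])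
qed

lemma Br_mult:
  assumes "F \<in> Br sc Hg act"
  shows "(\<lambda>vs. a * F vs) \<in> Br sc Hg act"
proof (rule BrI)
  show "multilin sc (\<lambda>vs. a * F vs)"
    using Br_multilin[OF assms] by (simp add: multilin_iff multilin_at_mult)
  fix R T assume R: "homs R" "T \<in> horb act R"
  show "a * F (map snd T) = a * F (map snd R)" by (simp only: Br_orbit[OF assms R])
qed

lemma Br_dact:
  assumes "F \<in> Br sc Hg act"
  shows "dact act g F \<in> Br sc Hg act"
proof -
  have "F (map snd (conjmap g T)) = F (map snd (conjmap g R))" if "homs R" "T \<in> horb act R" for R T
  proof -
    have "conjmap g T \<in> horb act (conjmap g R)"
      using that(2) horb_map[OF equivariant_conj, of g R] by (simp add: conjmap_def)
    then show ?thesis by (rule Br_orbit[OF assms homs_conjmap[OF that(1)]])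
  qed
  then show ?thesis using multilin_dact[OF Br_multilin[OF assms]] unfolding Br_iff dact_homs by blast
qed

lemma Br_dcomp:
  assumes "F \<in> Br sc Hg act"
  shows "dcomp Hg g F \<in> Br sc Hg act"
proof -
  note F = Br_multilin[OF assms]
  have "dcomp Hg g F (map snd T) = dcomp Hg g F (map snd R)" if "homs R" "T \<in> horb act R" for R T
    using dcomp_homs[OF F that(1), of g] dcomp_homs[OF F homs_horb[OF that], of g]
      sum_list_horb[OF that(2)] Br_orbit[OF assms that]
    by simp
  then show ?thesis using multilin_dcomp[OF F] unfolding Br_iff by blast
qed

lemma Br_unit1: "unit1 \<in> Br sc Hg act"
proof (rule BrI[OF multilin_unit1])
  fix R T assume "T \<in> horb act R"
  then have "length T = length R" by (rule horb_length)
  then show "unit1 (map snd T) = (unit1 (map snd R) :: 'k)" by (auto simp: unit1_def)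
qed

lemma braidize_add: "braidize Hg act (\<lambda>vs. F vs + G vs) = (\<lambda>vs. braidize Hg act F vs + braidize Hg act G vs)"
proof -
  have "gsact act a (hcomp Hg \<gamma> (\<lambda>vs. F vs + G vs)) vs
      = gsact act a (hcomp Hg \<gamma> F) vs + gsact act a (hcomp Hg \<gamma> G) vs" for a \<gamma> vs
    by (simp add: gsact_def hcomp_def)
  then show ?thesis
    by (simp add: fun_eq_iff braidize_def sum.distrib add_divide_distrib)
qed

lemma braidize_mult: "braidize Hg act (\<lambda>vs. a * F vs) = (\<lambda>vs. a * braidize Hg act F vs)"
proof -
  have "gsact act b (hcomp Hg \<gamma> (\<lambda>vs. a * F vs)) vs = a * gsact act b (hcomp Hg \<gamma> F) vs" for b \<gamma> vs
    by (simp add: gsact_def hcomp_def)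
  then show ?thesis
    by (simp add: fun_eq_iff braidize_def sum_distrib_left)
qed

section \<open>Laws of the braidized product\<close>

lemma circ_homs:
  assumes "multilin sc F" "multilin sc G" "homs R"
  shows "circ Hg act F G (map snd R)
    = (\<Sum>k\<le>length R. hav act (\<lambda>T. F (map snd (take k T)) * G (map snd (drop k T))) R)"
proof -
  have "circ Hg act F G (map snd R) = hav act (\<lambda>T. juxt F G (map snd T)) R"
    unfolding circ_def by (rule braidize_homs[OF multilin_juxt[OF assms(1,2)] assms(3)])
  also have "\<dots> = hav act (\<lambda>T. \<Sum>k\<le>length R. F (map snd (take k T)) * G (map snd (drop k T))) R"
    by (intro hav_cong) (simp add: juxt_def horb_length take_map drop_map)
  finally show ?thesis by (simp add: hav_sum)
qed

lemma circ_braidize_left: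
  assumes X: "multilin sc X" and E: "multilin sc E"
  shows "circ Hg act (braidize Hg act X) E = circ Hg act X E"
proof (rule multilin_ext)
  show "multilin sc (circ Hg act (braidize Hg act X) E)" "multilin sc (circ Hg act X E)"
    by (intro multilin_circ multilin_braidize X E)+
  fix R assume R: "homs R"
  have "hav act (\<lambda>T. braidize Hg act X (map snd (take k T)) * E (map snd (drop k T))) R
      = hav act (\<lambda>T. X (map snd (take k T)) * E (map snd (drop k T))) R" if "k \<le> length R" for k
  proof -
    let ?f = "\<lambda>T. X (map snd (take k T)) * E (map snd (drop k T))"
    \<comment> \<open>The inner braidization is an average over the first \<open>k\<close> strands;
      the \<open>0\<close> offsets bring it into the form of \<open>hav_block\<close>.\<close>
    have "hav act (\<lambda>T. braidize Hg act X (map snd (take k T)) * E (map snd (drop k T))) R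
        = hav act (\<lambda>T. hav act (\<lambda>S. ?f (take 0 T @ S @ drop (0 + k) T)) (take k (drop 0 T))) R"
    proof (rule hav_cong)
      fix T assume T: "T \<in> horb act R"
      have "braidize Hg act X (map snd (take k T)) * E (map snd (drop k T))
          = hav act (\<lambda>S. X (map snd S) * E (map snd (drop k T))) (take k T)"
        using braidize_homs[OF X homs_take[OF homs_horb[OF R T]]] by (simp add: hav_mult_right)
      also have "\<dots> = hav act (\<lambda>S. ?f (S @ drop k T)) (take k T)"
        using horb_length[OF T] that by (intro hav_cong) (auto dest!: horb_length)
      finally show "braidize Hg act X (map snd (take k T)) * E (map snd (drop k T))
          = hav act (\<lambda>S. ?f (take 0 T @ S @ drop (0 + k) T)) (take k (drop 0 T))" by simp
    qed
    also have "\<dots> = hav act ?f R" using that by (intro hav_block[OF group_act]) simp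
    finally show ?thesis .
  qed
  then show "circ Hg act (braidize Hg act X) E (map snd R) = circ Hg act X E (map snd R)"
    using X E R by (simp add: circ_homs multilin_braidize)
qed

lemma circ_braidize_right:
  assumes X: "multilin sc X" and E: "multilin sc E"
  shows "circ Hg act E (braidize Hg act X) = circ Hg act E X"
proof (rule multilin_ext)
  show "multilin sc (circ Hg act E (braidize Hg act X))" "multilin sc (circ Hg act E X)"
    by (intro multilin_circ multilin_braidize X E)+
  fix R assume R: "homs R"
  have "hav act (\<lambda>T. E (map snd (take k T)) * braidize Hg act X (map snd (drop k T))) R
      = hav act (\<lambda>T. E (map snd (take k T)) * X (map snd (drop k T))) R" if "k \<le> length R" for k
  proof -
    let ?f = "\<lambda>T. E (map snd (take k T)) * X (map snd (drop k T))"
    let ?m = "length R - k"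
    \<comment> \<open>Here the block consists of the last \<open>?m\<close> strands.\<close>
    have "hav act (\<lambda>T. E (map snd (take k T)) * braidize Hg act X (map snd (drop k T))) R
        = hav act (\<lambda>T. hav act (\<lambda>S. ?f (take k T @ S @ drop (k + ?m) T)) (take ?m (drop k T))) R"
    proof (rule hav_cong)
      fix T assume T: "T \<in> horb act R"
      have "E (map snd (take k T)) * braidize Hg act X (map snd (drop k T))
          = hav act (\<lambda>S. E (map snd (take k T)) * X (map snd S)) (drop k T)"
        using braidize_homs[OF X homs_drop[OF homs_horb[OF R T]]] by (simp add: hav_mult_left)
      also have "\<dots> = hav act (\<lambda>S. ?f (take k T @ S)) (drop k T)"
        using horb_length[OF T] that by (intro hav_cong) (auto dest!: horb_length)
      finally show "E (map snd (take k T)) * braidize Hg act X (map snd (drop k T))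
          = hav act (\<lambda>S. ?f (take k T @ S @ drop (k + ?m) T)) (take ?m (drop k T))"
        using horb_length[OF T] that by simp
    qed
    also have "\<dots> = hav act ?f R" using that by (intro hav_block[OF group_act]) simp
    finally show ?thesis .
  qed
  then show "circ Hg act E (braidize Hg act X) (map snd R) = circ Hg act E X (map snd R)"
    using X E R by (simp add: circ_homs multilin_braidize)
qed

text \<open>Both bracketings equal the braidization of the triple juxtaposition, because an inner
  braidization is absorbed by the outer one.\<close>

lemma circ_assoc:
  assumes "multilin sc F" "multilin sc G" "multilin sc E"
  shows "circ Hg act (circ Hg act F G) E = circ Hg act F (circ Hg act G E)"
proof -
  have "circ Hg act (circ Hg act F G) E = circ Hg act (juxt F G) E"
    using circ_braidize_left[OF multilin_juxt[OF assms(1,2)] assms(3)] by (simp add: circ_def)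
  also have "\<dots> = circ Hg act F (juxt G E)" by (simp add: circ_def juxt_assoc)
  also have "\<dots> = circ Hg act F (circ Hg act G E)"
    using circ_braidize_right[OF multilin_juxt[OF assms(2,3)] assms(1)] by (simp add: circ_def)
  finally show ?thesis .
qed

lemma circ_dact:
  assumes "multilin sc F" "multilin sc G"
  shows "dact act g (circ Hg act F G) = circ Hg act (dact act g F) (dact act g G)"
proof (rule multilin_ext)
  show "multilin sc (dact act g (circ Hg act F G))" "multilin sc (circ Hg act (dact act g F) (dact act g G))"
    by (intro multilin_dact multilin_circ assms)+
  fix R assume R: "homs R"
  have "hav act (\<lambda>T. F (map snd (take k T)) * G (map snd (drop k T))) (conjmap g R)
      = hav act (\<lambda>T. F (map snd (conjmap g (take k T))) * G (map snd (conjmap g (drop k T)))) R" for k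
    unfolding conjmap_def
    by (simp add: hav_map[OF equivariant_conj group_act group_act] take_map drop_map)
  then show "dact act g (circ Hg act F G) (map snd R) = circ Hg act (dact act g F) (dact act g G) (map snd R)"
    using R homs_conjmap[OF R, of g]
    by (simp add: dact_homs circ_homs assms multilin_dact) (simp add: conjmap_def)
qed

text \<open>Braids preserve the total degree. If it is not \<open>a + b\<close>, then at every cut
  of every list in the orbit one of the two factors has the wrong degree and vanishes.\<close>

lemma circ_dcomp:
  assumes F: "multilin sc F" and G: "multilin sc G"
  shows "dcomp Hg (a + b) (circ Hg act (dcomp Hg a F) (dcomp Hg b G))
    = circ Hg act (dcomp Hg a F) (dcomp Hg b G)"
proof (rule multilin_ext)
  show m: "multilin sc (circ Hg act (dcomp Hg a F) (dcomp Hg b G))"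
    by (intro multilin_dcomp multilin_circ F G)
  then show "multilin sc (dcomp Hg (a + b) (circ Hg act (dcomp Hg a F) (dcomp Hg b G)))"
    by (rule multilin_dcomp)
  fix R assume R: "homs R"
  have "circ Hg act (dcomp Hg a F) (dcomp Hg b G) (map snd R) = 0" if "sum_list (map fst R) \<noteq> a + b"
  proof -
    have "dcomp Hg a F (map snd (take k T)) * dcomp Hg b G (map snd (drop k T)) = 0"
      if T: "T \<in> horb act R" for T k
    proof -
      have "sum_list (map fst (take k T)) + sum_list (map fst (drop k T)) = sum_list (map fst T)"
        by (metis append_take_drop_id map_append sum_list_append)
      then have "sum_list (map fst (take k T)) \<noteq> a \<or> sum_list (map fst (drop k T)) \<noteq> b"
        using \<open>sum_list (map fst R) \<noteq> a + b\<close> sum_list_horb[OF T] by auto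
      then show ?thesis
        using dcomp_homs[OF F homs_take[OF homs_horb[OF R T]]] dcomp_homs[OF G homs_drop[OF homs_horb[OF R T]]]
        by auto
    qed
    then show ?thesis
      unfolding circ_homs[OF multilin_dcomp[OF F] multilin_dcomp[OF G] R]
      by (intro sum.neutral ballI hav_const[OF group_act])
  qed
  then show "dcomp Hg (a + b) (circ Hg act (dcomp Hg a F) (dcomp Hg b G)) (map snd R)
    = circ Hg act (dcomp Hg a F) (dcomp Hg b G) (map snd R)"
    by (simp add: dcomp_homs[OF m R])
qed

text \<open>The word \<open>swap_word\<close> carries the second block of strands over the first and realises
  the braiding of the two tensor factors; it permutes the orbit, so the average does not see it.\<close>

lemma circ_comm:
  assumes F: "multilin sc F" and G: "multilin sc G"
  shows "circ Hg act F G = (\<lambda>vs. \<Sum>g\<in>UNIV. circ Hg act (dact act g G) (dcomp Hg g F) vs)"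
proof (rule multilin_ext)
  have m: "multilin sc (circ Hg act (dact act g G) (dcomp Hg g F))" for g
    by (intro multilin_circ multilin_dact multilin_dcomp F G)
  show "multilin sc (circ Hg act F G)" by (intro multilin_circ F G)
  show "multilin sc (\<lambda>vs. \<Sum>g\<in>UNIV. circ Hg act (dact act g G) (dcomp Hg g F) vs)"
    using m unfolding multilin_iff by (intro allI multilin_at_sum) auto
  fix R assume R: "homs R"
  let ?n = "length R"
  let ?f = "\<lambda>k T. F (map snd (take k T)) * G (map snd (drop k T))"
  have "(\<Sum>g\<in>UNIV. circ Hg act (dact act g G) (dcomp Hg g F) (map snd R))
    = (\<Sum>l\<le>?n. \<Sum>g\<in>UNIV. hav act (\<lambda>T. dact act g G (map snd (take l T)) * dcomp Hg g F (map snd (drop l T))) R)"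
    by (simp add: circ_homs[OF multilin_dact[OF G] multilin_dcomp[OF F] R]) (rule sum.swap)
  also have "\<dots> = (\<Sum>l\<le>?n. hav act (?f (?n - l)) R)"
  proof (rule sum.cong[OF refl])
    fix l assume "l \<in> {..?n}"
    then have l: "l \<le> ?n" by simp
    have "(\<Sum>g\<in>UNIV. hav act (\<lambda>T. dact act g G (map snd (take l T)) * dcomp Hg g F (map snd (drop l T))) R)
      = hav act (\<lambda>T. \<Sum>g\<in>UNIV. dact act g G (map snd (take l T)) * dcomp Hg g F (map snd (drop l T))) R"
      by (simp add: hav_sum)
    also have "\<dots> = hav act (\<lambda>T. ?f (?n - l) (hword act (swap_word l (?n - l)) T)) R"
    proof (rule hav_cong)
      fix T assume T: "T \<in> horb act R"
      let ?s = "sum_list (map fst (drop l T))"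
      have len: "length (take l T) = l" "length (drop l T) = ?n - l"
        using horb_length[OF T] l by simp_all
      have w: "hword act (swap_word l (?n - l)) T = drop l T @ conjmap ?s (take l T)"
        using hword_swap_word[OF group_act, of "take l T" "drop l T" "[]"] len by (simp add: conjmap_def)
      \<comment> \<open>\<open>dcomp\<close> keeps only the \<open>g\<close> equal to the total
        degree of the second block. For this \<open>g\<close>, \<open>dact\<close> evaluates
        \<open>G\<close> at the conjugated first block, which is what \<open>swap_word\<close> puts
        behind the second block.\<close>
      have "(\<Sum>g\<in>UNIV. dact act g G (map snd (take l T)) * dcomp Hg g F (map snd (drop l T)))
        = (\<Sum>g\<in>UNIV. if ?s = g then G (map snd (conjmap g (take l T))) * F (map snd (drop l T)) else 0)"
        using dcomp_homs[OF F homs_drop[OF homs_horb[OF R T]]]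
        by (intro sum.cong) (auto simp: dact_homs)
      also have "\<dots> = G (map snd (conjmap ?s (take l T))) * F (map snd (drop l T))"
        by simp
      finally show "(\<Sum>g\<in>UNIV. dact act g G (map snd (take l T)) * dcomp Hg g F (map snd (drop l T)))
        = ?f (?n - l) (hword act (swap_word l (?n - l)) T)"
        using len by (simp add: w mult.commute)
    qed
    also have "\<dots> = hav act (?f (?n - l)) R"
      using l by (intro hav_hword[OF group_act] valid_swap_word) simp
    finally show "(\<Sum>g\<in>UNIV. hav act (\<lambda>T. dact act g G (map snd (take l T)) * dcomp Hg g F (map snd (drop l T))) R)
      = hav act (?f (?n - l)) R" .
  qed
  also have "\<dots> = (\<Sum>k\<le>?n. hav act (?f k) R)"
    by (rule sum.reindex_bij_witness[where i = "\<lambda>k. ?n - k" and j = "\<lambda>k. ?n - k"]) auto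
  also have "\<dots> = circ Hg act F G (map snd R)" by (simp add: circ_homs[OF F G R])
  finally show "circ Hg act F G (map snd R)
    = (\<Sum>g\<in>UNIV. circ Hg act (dact act g G) (dcomp Hg g F) (map snd R))" by simp
qed

lemma circ_add_mult:
  "circ Hg act (\<lambda>vs. F vs + F' vs) G = (\<lambda>vs. circ Hg act F G vs + circ Hg act F' G vs)"
  "circ Hg act F (\<lambda>vs. G vs + G' vs) = (\<lambda>vs. circ Hg act F G vs + circ Hg act F G' vs)"
  "circ Hg act (\<lambda>vs. a * F vs) G = (\<lambda>vs. a * circ Hg act F G vs)"
  "circ Hg act F (\<lambda>vs. a * G vs) = (\<lambda>vs. a * circ Hg act F G vs)"
proof -
  have "juxt (\<lambda>vs. F vs + F' vs) G = (\<lambda>vs. juxt F G vs + juxt F' G vs)"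
    "juxt F (\<lambda>vs. G vs + G' vs) = (\<lambda>vs. juxt F G vs + juxt F G' vs)"
    "juxt (\<lambda>vs. a * F vs) G = (\<lambda>vs. a * juxt F G vs)"
    "juxt F (\<lambda>vs. a * G vs) = (\<lambda>vs. a * juxt F G vs)"
    by (simp_all add: fun_eq_iff juxt_def algebra_simps sum.distrib sum_distrib_left)
  then show "circ Hg act (\<lambda>vs. F vs + F' vs) G = (\<lambda>vs. circ Hg act F G vs + circ Hg act F' G vs)"
    "circ Hg act F (\<lambda>vs. G vs + G' vs) = (\<lambda>vs. circ Hg act F G vs + circ Hg act F G' vs)"
    "circ Hg act (\<lambda>vs. a * F vs) G = (\<lambda>vs. a * circ Hg act F G vs)"
    "circ Hg act F (\<lambda>vs. a * G vs) = (\<lambda>vs. a * circ Hg act F G vs)"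
    by (simp_all add: circ_def braidize_add braidize_mult)
qed

theorem Br_braided_comm_unital_algebra: "braided_comm_unital_algebra sc Hg act"
proof -
  have "(\<lambda>_. 0) \<in> Br sc Hg act"
    using Br_mult[OF Br_unit1, of 0] by simp
  then show ?thesis
    unfolding braided_comm_unital_algebra_def Let_def
    by (intro conjI ballI allI Br_add Br_mult Br_dact Br_dcomp Br_unit1 circ_add_mult circ_dact circ_dcomp
        circ_assoc circ_comm Br_multilin)
      (simp_all add: circ_def juxt_unit1 braidize_Br braidize_in_Br multilin_juxt Br_multilin)
qed

end

section \<open>Functoriality\<close>

theorem pullback_unital_alg_hom:
  assumes "graded_module scH HgH actH" "graded_module scK HgK actK"
    and \<phi>: "ggmorph scH HgH actH scK HgK actK \<phi>"
  shows "unital_alg_hom scH HgH actH scK HgK actK (pullback \<phi>)"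
proof -
  interpret H: graded_module scH HgH actH by fact
  interpret K: graded_module scK HgK actK by fact
  have "Vector_Spaces.linear scH scK \<phi>" using \<phi> by (simp add: ggmorph_def)
  then interpret L: Vector_Spaces.linear scH scK \<phi> .
  let ?h = "map (map_prod (\<lambda>c. c) \<phi>)"
  have equivariant: "equivariant actH actK (\<lambda>c. c) \<phi>" using \<phi> by (simp add: equivariant_def ggmorph_def)
  have homs: "K.homs (?h R)" if "H.homs R" for R
    using that \<phi> by (fastforce simp: H.homs_def K.homs_def ggmorph_def)
  have pb: "pullback \<phi> F (map snd R) = F (map snd (?h R))" for F :: "'d list \<Rightarrow> 'a" and R :: "('c \<times> 'b) list"
    by (simp add: pullback_def o_def snd_map_prod)
  have multilin: "multilin scH (pullback \<phi> F)" if "multilin scK F" for F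
    using that by (simp add: multilin_def pullback_def L.add L.scale)
  have Br: "pullback \<phi> F \<in> Br scH HgH actH" if F: "F \<in> Br scK HgK actK" for F
  proof -
    have "F (map snd (?h T)) = F (map snd (?h R))" if "H.homs R" "T \<in> horb actH R" for R T
    proof -
      have "?h T \<in> horb actK (?h R)" using that(2) horb_map[OF equivariant, of R] by simp
      then show ?thesis by (rule K.Br_orbit[OF F homs[OF that(1)]])
    qed
    then show ?thesis using multilin[OF K.Br_multilin[OF F]] unfolding H.Br_iff pb by blast
  qed
  have circ: "pullback \<phi> (circ HgK actK F G) = circ HgH actH (pullback \<phi> F) (pullback \<phi> G)"
    if "F \<in> Br scK HgK actK" "G \<in> Br scK HgK actK" for F G
  proof (rule H.multilin_ext)
    note FG = that[THEN K.Br_multilin]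
    show "multilin scH (pullback \<phi> (circ HgK actK F G))" by (intro multilin K.multilin_circ FG)
    show "multilin scH (circ HgH actH (pullback \<phi> F) (pullback \<phi> G))" by (intro multilin H.multilin_circ FG)
    fix R assume R: "H.homs R"
    \<comment> \<open>A morphism preserves degrees and can identify vectors, so the image orbit may
      be smaller; \<open>hav_map\<close> shows that the averages still agree.\<close>
    have "hav actK (\<lambda>T. F (map snd (take k T)) * G (map snd (drop k T))) (?h R)
      = hav actH (\<lambda>T. F (map snd (?h (take k T))) * G (map snd (?h (drop k T)))) R" for k
      by (simp add: hav_map[OF equivariant H.group_act K.group_act] take_map drop_map)
    then show "pullback \<phi> (circ HgK actK F G) (map snd R)
      = circ HgH actH (pullback \<phi> F) (pullback \<phi> G) (map snd R)"
      using K.circ_homs[OF FG homs[OF R]] H.circ_homs[OF FG[THEN multilin] R] by (simp only: pb length_map)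
  qed
  show ?thesis
    unfolding unital_alg_hom_def using Br circ by (auto simp: pullback_def unit1_def fun_eq_iff)
qed

theorem theorem2p34:
  fixes scH :: "'k::field_char_0 \<Rightarrow> 'h::ab_group_add \<Rightarrow> 'h"
    and HgH :: "'g::{group_add,finite} \<Rightarrow> 'h set"
    and actH :: "'g \<Rightarrow> 'h \<Rightarrow> 'h"
    and scK :: "'k \<Rightarrow> 'v::ab_group_add \<Rightarrow> 'v"
    and HgK :: "'g \<Rightarrow> 'v set"
    and actK :: "'g \<Rightarrow> 'v \<Rightarrow> 'v"
  assumes H: "fdggmod scH HgH actH"
    and K: "fdggmod scK HgK actK"
  shows "braided_comm_unital_algebra scH HgH actH \<and>
         (\<forall>\<phi>. ggmorph scH HgH actH scK HgK actK \<phi> \<longrightarrow>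
               unital_alg_hom scH HgH actH scK HgK actK (pullback \<phi>))"
proof -
  have "graded_module scH HgH actH" "graded_module scK HgK actK"
    using H K by (simp_all add: fdggmod_def graded_module_def)
  then show ?thesis
    using graded_module.Br_braided_comm_unital_algebra pullback_unital_alg_hom by blast
qed

end
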